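(* Let $\mathcal{M}$ be a preadditive braided monoidal category with equalizers. Assume that the tensor functors are additive and preserve equalizers. Then $$P_{\mathrm{Br}}\circ J_{\mathrm{Bialg}}=J\circ P:\mathrm{Bialg}_{\mathcal{M}}\to\mathrm{Br}_{\mathcal{M}}.$$ Furthermore $$\xi J_{\mathrm{Bialg}}=J\xi .$$
   Context: Associativity constraints of $\mathcal M$ are suppressed; $l_X:\mathbf 1\otimes X\to X$, $r_X:X\otimes\mathbf 1\to X$; an object also denotes its identity morphism. The tensor functors are $M\otimes(-)$ and $(-)\otimes M$ for all objects $M$. $c_{U,V}:U\otimes V\to V\otimes U$ is the braiding of $\mathcal M$. $\Delta_{\mathbf 1}=l_{\mathbf 1}^{-1}=r_{\mathbf 1}^{-1}$, $m_{\mathbf 1}=l_{\mathbf 1}=r_{\mathbf 1}$. A braided object is a pair $(V,c)$ with $c:V\otimes V\to V\otimes V$ invertible and $(c\otimes V)(V\otimes c)(c\otimes V)=(V\otimes c)(c\otimes V)(V\otimes c)$; a morphism $(V,c_V)\to(W,c_W)$ is $f:V\to W$ with $c_W(f\otimes f)=(f\otimes f)c_V$; category $\mathrm{Br}_{\mathcal M}$, forgetful functor $H:\mathrm{Br}_{\mathcal M}\to\mathcal M$. A braided algebra is $(A,m,u,c)$ with $(A,m,u)$ an algebra, $(A,c)$ a braided object, and $c(m\otimes A)=(A\otimes m)(c\otimes A)(A\otimes c)$, $c(A\otimes m)=(m\otimes A)(A\otimes c)(c\otimes A)$, $c(u\otimes A)l_A^{-1}=(A\otimes u)r_A^{-1}$,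 $c(A\otimes u)r_A^{-1}=(u\otimes A)l_A^{-1}$. A braided coalgebra is $(C,\Delta,\varepsilon,c)$ with $(C,\Delta,\varepsilon)$ a coalgebra, $(C,c)$ a braided object, and $(\Delta\otimes C)c=(C\otimes c)(c\otimes C)(C\otimes\Delta)$, $(C\otimes\Delta)c=(c\otimes C)(C\otimes c)(\Delta\otimes C)$, $l_C(\varepsilon\otimes C)c=r_C(C\otimes\varepsilon)$, $r_C(C\otimes\varepsilon)c=l_C(\varepsilon\otimes C)$. A braided bialgebra is $(B,m,u,\Delta,\varepsilon,c)$ with $(B,m,u,c)$ a braided algebra, $(B,\Delta,\varepsilon,c)$ a braided coalgebra, and $\Delta m=(m\otimes m)(B\otimes c\otimes B)(\Delta\otimes\Delta)$, $\Delta u=(u\otimes u)\Delta_{\mathbf 1}$, $\varepsilon m=m_{\mathbf 1}(\varepsilon\otimes\varepsilon)$, $\varepsilon u=\mathrm{Id}_{\mathbf 1}$; morphisms are algebra and coalgebra morphisms that are morphisms of braided objects; category $\mathrm{BrBialg}_{\mathcal M}$. $\mathrm{Bialg}_{\mathcal M}$ is the category of bialgebras in the braided monoidal category $\mathcal M$: quintuples $(B,m,u,\Delta,\varepsilon)$ with $(B,m,u)$ an algebra and $(B,\Delta,\varepsilon)$ a coalgebra such that $\Delta,\varepsilon$ are algebra morphisms, $B\otimes B$ being an algebra via $(m\otimes m)(B\otimes c_{B,B}\otimes B)$ and $(u\otimes u)l_{\mathbf 1}^{-1}$; morphisms are algebra and coalgebra morphisms. $J:\mathcal M\to\mathrm{Br}_{\mathcal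 M}$, $JV=(V,c_{V,V})$, and $J_{\mathrm{Bialg}}:\mathrm{Bialg}_{\mathcal M}\to\mathrm{BrBialg}_{\mathcal M}$, $(B,m_B,u_B,\Delta_B,\varepsilon_B)\mapsto(B,m_B,u_B,\Delta_B,\varepsilon_B,c_{B,B})$, both acting as the identity on morphisms. Braided primitive functor $P_{\mathrm{Br}}:\mathrm{BrBialg}_{\mathcal M}\to\mathrm{Br}_{\mathcal M}$: for $\mathbb A=(A,m_A,u_A,\Delta_A,\varepsilon_A,c_A)$, $\xi\mathbb A:P(\mathbb A)\to A$ is a chosen equalizer of $\Delta_A$ and $(A\otimes u_A)r_A^{-1}+(u_A\otimes A)l_A^{-1}$, and $P_{\mathrm{Br}}(\mathbb A)=(P(\mathbb A),c_{P(\mathbb A)})$ where $c_{P(\mathbb A)}$ is the unique morphism with $(\xi\mathbb A\otimes\xi\mathbb A)c_{P(\mathbb A)}=c_A(\xi\mathbb A\otimes\xi\mathbb A)$; $P_{\mathrm{Br}}(f)$ is the unique morphism with $\xi\mathbb A'\circ P_{\mathrm{Br}}(f)=f\circ\xi\mathbb A$. So $\xi$ is a natural transformation from $P_{\mathrm{Br}}$ to the forgetful functor $\mathrm{BrBialg}_{\mathcal M}\to\mathrm{Br}_{\mathcal M}$. Primitive functor: $P:=H\circ P_{\mathrm{Br}}\circ J_{\mathrm{Bialg}}:\mathrm{Bialg}_{\mathcal M}\to\mathcal M$. For $\mathbb B=(B,m_B,u_B,\Delta_B,\varepsilon_B)\in\mathrm{Bialg}_{\mathcal M}$, the canonical morphism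 is denoted again $\xi\mathbb B:P(\mathbb B)\to B$; it is the (same chosen) equalizer of $\Delta_B$ and $(B\otimes u_B)r_B^{-1}+(u_B\otimes B)l_B^{-1}$. In $\xi J_{\mathrm{Bialg}}=J\xi$ the left $\xi$ is the one on $\mathrm{BrBialg}_{\mathcal M}$ and the right $\xi$ the one on $\mathrm{Bialg}_{\mathcal M}$. *)

theory Defs
  imports "HOL-Algebra.Group"
begin

section \<open>Categories, functors, natural transformations\<close>

record ('o, 'm) cat =
  Obj :: "'o set"
  Arr :: "'m set"
  Dom :: "'m \<Rightarrow> 'o"
  Cod :: "'m \<Rightarrow> 'o"
  Idt :: "'o \<Rightarrow> 'm"  ("\<iota>\<index>")
  Cmp :: "'m \<Rightarrow> 'm \<Rightarrow> 'm"  (infixr "\<cdot>\<index>" 68)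

definition Hom :: "('o, 'm, 'z) cat_scheme \<Rightarrow> 'o \<Rightarrow> 'o \<Rightarrow> 'm set" where
  "Hom C X Y = {f \<in> Arr C. Dom C f = X \<and> Cod C f = Y}"

locale category =
  fixes C :: "('o, 'm, 'z) cat_scheme" (structure)
  assumes Dom_Obj: "f \<in> Arr C \<Longrightarrow> Dom C f \<in> Obj C"
    and Cod_Obj: "f \<in> Arr C \<Longrightarrow> Cod C f \<in> Obj C"
    and Idt_Hom: "X \<in> Obj C \<Longrightarrow> \<iota> X \<in> Hom C X X"
    and Cmp_Hom: "\<lbrakk>f \<in> Hom C X Y; g \<in> Hom C Y Z\<rbrakk> \<Longrightarrow> g \<cdot> f \<in> Hom C X Z"
    and Cmp_Idt_left: "f \<in> Hom C X Y \<Longrightarrow> \<iota> Y \<cdot> f = f"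
    and Cmp_Idt_right: "f \<in> Hom C X Y \<Longrightarrow> f \<cdot> \<iota> X = f"
    and Cmp_assoc: "\<lbrakk>f \<in> Hom C W X; g \<in> Hom C X Y; h \<in> Hom C Y Z\<rbrakk>
      \<Longrightarrow> (h \<cdot> g) \<cdot> f = h \<cdot> (g \<cdot> f)"

definition is_inverse :: "('o, 'm, 'z) cat_scheme \<Rightarrow> 'm \<Rightarrow> 'm \<Rightarrow> bool" where
  "is_inverse C f g \<longleftrightarrow> f \<in> Arr C \<and> g \<in> Hom C (Cod C f) (Dom C f)
     \<and> g \<cdot> f = \<iota> (Dom C f) \<and> f \<cdot> g = \<iota> (Cod C f)" for C (structure)

definition is_iso :: "('o, 'm, 'z) cat_scheme \<Rightarrow> 'm \<Rightarrow> bool" where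
  "is_iso C f \<longleftrightarrow> (\<exists>g. is_inverse C f g)"

definition Inv :: "('o, 'm, 'z) cat_scheme \<Rightarrow> 'm \<Rightarrow> 'm" where
  "Inv C f = (THE g. is_inverse C f g)"

definition is_equalizer :: "('o, 'm, 'z) cat_scheme \<Rightarrow> 'm \<Rightarrow> 'm \<Rightarrow> 'm \<Rightarrow> bool" where
  "is_equalizer C e f g \<longleftrightarrow>
     e \<in> Arr C \<and> f \<in> Arr C \<and> g \<in> Hom C (Dom C f) (Cod C f) \<and> Cod C e = Dom C f
     \<and> f \<cdot> e = g \<cdot> e
     \<and> (\<forall>h \<in> Arr C. Cod C h = Dom C f \<and> f \<cdot> h = g \<cdot> h
           \<longrightarrow> (\<exists>!k. k \<in> Hom C (Dom C h) (Dom C e) \<and> e \<cdot> k = h))" for C (structure)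

definition has_equalizers :: "('o, 'm, 'z) cat_scheme \<Rightarrow> bool" where
  "has_equalizers C \<longleftrightarrow>
     (\<forall>f \<in> Arr C. \<forall>g \<in> Hom C (Dom C f) (Cod C f). \<exists>e. is_equalizer C e f g)"

datatype ('o1, 'm1, 'o2, 'm2) ftor =
  Ftor (on_obj: "'o1 \<Rightarrow> 'o2") (on_arr: "'m1 \<Rightarrow> 'm2")

definition is_functor ::
  "('o1, 'm1, 'y) cat_scheme \<Rightarrow> ('o2, 'm2, 'z) cat_scheme \<Rightarrow> ('o1, 'm1, 'o2, 'm2) ftor \<Rightarrow> bool" where
  "is_functor C D F \<longleftrightarrow>
     (\<forall>X \<in> Obj C. on_obj F X \<in> Obj D)
     \<and> (\<forall>f \<in> Arr C. on_arr F f \<in> Hom D (on_obj F (Dom C f)) (on_obj F (Cod C f)))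
     \<and> (\<forall>X \<in> Obj C. on_arr F (\<iota>\<^bsub>C\<^esub> X) = \<iota>\<^bsub>D\<^esub> (on_obj F X))
     \<and> (\<forall>f \<in> Arr C. \<forall>g \<in> Arr C. Cod C f = Dom C g
           \<longrightarrow> on_arr F (g \<cdot>\<^bsub>C\<^esub> f) = on_arr F g \<cdot>\<^bsub>D\<^esub> on_arr F f)"

definition fcomp :: "('o2, 'm2, 'o3, 'm3) ftor \<Rightarrow> ('o1, 'm1, 'o2, 'm2) ftor
    \<Rightarrow> ('o1, 'm1, 'o3, 'm3) ftor"  (infixr "\<circ>\<^sub>F" 70) where
  "G \<circ>\<^sub>F F = Ftor (on_obj G \<circ> on_obj F) (on_arr G \<circ> on_arr F)"

text \<open>Equality of functors from \<^term>\<open>C\<close> to \<^term>\<open>D\<close>: both are such functors, and they agree on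
  the objects and arrows of \<^term>\<open>C\<close>; values outside \<^term>\<open>C\<close> are immaterial.\<close>

definition functor_eq :: "('o1, 'm1, 'y) cat_scheme \<Rightarrow> ('o2, 'm2, 'z) cat_scheme
    \<Rightarrow> ('o1, 'm1, 'o2, 'm2) ftor \<Rightarrow> ('o1, 'm1, 'o2, 'm2) ftor \<Rightarrow> bool" where
  "functor_eq C D F G \<longleftrightarrow> is_functor C D F \<and> is_functor C D G
     \<and> (\<forall>X \<in> Obj C. on_obj F X = on_obj G X) \<and> (\<forall>f \<in> Arr C. on_arr F f = on_arr G f)"

definition preserves_equalizers ::
  "('o1, 'm1, 'y) cat_scheme \<Rightarrow> ('o2, 'm2, 'z) cat_scheme \<Rightarrow> ('o1, 'm1, 'o2, 'm2) ftor \<Rightarrow> bool" where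
  "preserves_equalizers C D F \<longleftrightarrow>
     (\<forall>e f g. is_equalizer C e f g
        \<longrightarrow> is_equalizer D (on_arr F e) (on_arr F f) (on_arr F g))"

datatype ('o1, 'm1, 'o2, 'm2) ntrans =
  NTrans (nt_src: "('o1, 'm1, 'o2, 'm2) ftor") (nt_tgt: "('o1, 'm1, 'o2, 'm2) ftor")
    (nt_comp: "'o1 \<Rightarrow> 'm2")

definition is_ntrans ::
  "('o1, 'm1, 'y) cat_scheme \<Rightarrow> ('o2, 'm2, 'z) cat_scheme \<Rightarrow> ('o1, 'm1, 'o2, 'm2) ntrans \<Rightarrow> bool" where
  "is_ntrans C D \<tau> \<longleftrightarrow> is_functor C D (nt_src \<tau>) \<and> is_functor C D (nt_tgt \<tau>)
     \<and> (\<forall>X \<in> Obj C. nt_comp \<tau> X \<in> Hom D (on_obj (nt_src \<tau>) X) (on_obj (nt_tgt \<tau>) X))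
     \<and> (\<forall>f \<in> Arr C. nt_comp \<tau> (Cod C f) \<cdot>\<^bsub>D\<^esub> on_arr (nt_src \<tau>) f
                   = on_arr (nt_tgt \<tau>) f \<cdot>\<^bsub>D\<^esub> nt_comp \<tau> (Dom C f))"

definition ntrans_eq :: "('o1, 'm1, 'y) cat_scheme \<Rightarrow> ('o2, 'm2, 'z) cat_scheme
    \<Rightarrow> ('o1, 'm1, 'o2, 'm2) ntrans \<Rightarrow> ('o1, 'm1, 'o2, 'm2) ntrans \<Rightarrow> bool" where
  "ntrans_eq C D \<sigma> \<tau> \<longleftrightarrow> is_ntrans C D \<sigma> \<and> is_ntrans C D \<tau>
     \<and> functor_eq C D (nt_src \<sigma>) (nt_src \<tau>) \<and> functor_eq C D (nt_tgt \<sigma>) (nt_tgt \<tau>)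
     \<and> (\<forall>X \<in> Obj C. nt_comp \<sigma> X = nt_comp \<tau> X)"

text \<open>The whiskerings \<open>\<tau>F\<close> and \<open>G\<tau>\<close>.\<close>

definition whisker_right :: "('o2, 'm2, 'o3, 'm3) ntrans \<Rightarrow> ('o1, 'm1, 'o2, 'm2) ftor
    \<Rightarrow> ('o1, 'm1, 'o3, 'm3) ntrans"  (infixr "\<star>\<^sub>R" 70) where
  "\<tau> \<star>\<^sub>R F = NTrans (nt_src \<tau> \<circ>\<^sub>F F) (nt_tgt \<tau> \<circ>\<^sub>F F) (\<lambda>X. nt_comp \<tau> (on_obj F X))"

definition whisker_left :: "('o2, 'm2, 'o3, 'm3) ftor \<Rightarrow> ('o1, 'm1, 'o2, 'm2) ntrans
    \<Rightarrow> ('o1, 'm1, 'o3, 'm3) ntrans"  (infixr "\<star>\<^sub>L" 70) where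
  "G \<star>\<^sub>L \<tau> = NTrans (G \<circ>\<^sub>F nt_src \<tau>) (G \<circ>\<^sub>F nt_tgt \<tau>) (\<lambda>X. on_arr G (nt_comp \<tau> X))"


section \<open>Preadditive braided monoidal categories\<close>

record ('o, 'm) moncat = "('o, 'm) cat" +
  TensO :: "'o \<Rightarrow> 'o \<Rightarrow> 'o"  (infix "\<otimes>\<^sub>o\<index>" 70)
  TensA :: "'m \<Rightarrow> 'm \<Rightarrow> 'm"  (infix "\<otimes>\<^sub>a\<index>" 70)
  UnitO :: "'o"  ("\<I>\<index>")
  Assoc :: "'o \<Rightarrow> 'o \<Rightarrow> 'o \<Rightarrow> 'm"  ("\<a>\<index>")
  LUnit :: "'o \<Rightarrow> 'm"  ("\<l>\<index>")
  RUnit :: "'o \<Rightarrow> 'm"  ("\<r>\<index>")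

text \<open>Not assumed strict: \<open>\<a> X Y Z : (X \<otimes> Y) \<otimes> Z \<rightarrow> X \<otimes> (Y \<otimes> Z)\<close>.\<close>

locale monoidal_category = category M
  for M :: "('o, 'm, 'z) moncat_scheme" (structure) +
  assumes TensO_Obj: "\<lbrakk>X \<in> Obj M; Y \<in> Obj M\<rbrakk> \<Longrightarrow> X \<otimes>\<^sub>o Y \<in> Obj M"
    and UnitO_Obj: "\<I> \<in> Obj M"
    and TensA_Hom: "\<lbrakk>f \<in> Hom M X X'; g \<in> Hom M Y Y'\<rbrakk>
      \<Longrightarrow> f \<otimes>\<^sub>a g \<in> Hom M (X \<otimes>\<^sub>o Y) (X' \<otimes>\<^sub>o Y')"
    and TensA_Idt: "\<lbrakk>X \<in> Obj M; Y \<in> Obj M\<rbrakk> \<Longrightarrow> \<iota> X \<otimes>\<^sub>a \<iota> Y = \<iota> (X \<otimes>\<^sub>o Y)"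
    and TensA_Cmp: "\<lbrakk>f \<in> Hom M X X'; f' \<in> Hom M X' X''; g \<in> Hom M Y Y'; g' \<in> Hom M Y' Y''\<rbrakk>
      \<Longrightarrow> (f' \<cdot> f) \<otimes>\<^sub>a (g' \<cdot> g) = (f' \<otimes>\<^sub>a g') \<cdot> (f \<otimes>\<^sub>a g)"
    and Assoc_Hom: "\<lbrakk>X \<in> Obj M; Y \<in> Obj M; Z \<in> Obj M\<rbrakk>
      \<Longrightarrow> \<a> X Y Z \<in> Hom M ((X \<otimes>\<^sub>o Y) \<otimes>\<^sub>o Z) (X \<otimes>\<^sub>o (Y \<otimes>\<^sub>o Z))"
    and Assoc_iso: "\<lbrakk>X \<in> Obj M; Y \<in> Obj M; Z \<in> Obj M\<rbrakk> \<Longrightarrow> is_iso M (\<a> X Y Z)"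
    and Assoc_natural: "\<lbrakk>f \<in> Hom M X X'; g \<in> Hom M Y Y'; h \<in> Hom M Z Z'\<rbrakk>
      \<Longrightarrow> \<a> X' Y' Z' \<cdot> ((f \<otimes>\<^sub>a g) \<otimes>\<^sub>a h) = (f \<otimes>\<^sub>a (g \<otimes>\<^sub>a h)) \<cdot> \<a> X Y Z"
    and LUnit_Hom: "X \<in> Obj M \<Longrightarrow> \<l> X \<in> Hom M (\<I> \<otimes>\<^sub>o X) X"
    and LUnit_iso: "X \<in> Obj M \<Longrightarrow> is_iso M (\<l> X)"
    and LUnit_natural: "f \<in> Hom M X Y \<Longrightarrow> \<l> Y \<cdot> (\<iota> \<I> \<otimes>\<^sub>a f) = f \<cdot> \<l> X"
    and RUnit_Hom: "X \<in> Obj M \<Longrightarrow> \<r> X \<in> Hom M (X \<otimes>\<^sub>o \<I>) X"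
    and RUnit_iso: "X \<in> Obj M \<Longrightarrow> is_iso M (\<r> X)"
    and RUnit_natural: "f \<in> Hom M X Y \<Longrightarrow> \<r> Y \<cdot> (f \<otimes>\<^sub>a \<iota> \<I>) = f \<cdot> \<r> X"
    and pentagon: "\<lbrakk>W \<in> Obj M; X \<in> Obj M; Y \<in> Obj M; Z \<in> Obj M\<rbrakk>
      \<Longrightarrow> \<a> W X (Y \<otimes>\<^sub>o Z) \<cdot> \<a> (W \<otimes>\<^sub>o X) Y Z
        = (\<iota> W \<otimes>\<^sub>a \<a> X Y Z) \<cdot> \<a> W (X \<otimes>\<^sub>o Y) Z \<cdot> (\<a> W X Y \<otimes>\<^sub>a \<iota> Z)"
    and triangle: "\<lbrakk>X \<in> Obj M; Y \<in> Obj M\<rbrakk>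
      \<Longrightarrow> (\<iota> X \<otimes>\<^sub>a \<l> Y) \<cdot> \<a> X \<I> Y = \<r> X \<otimes>\<^sub>a \<iota> Y"

record ('o, 'm) brmoncat = "('o, 'm) moncat" +
  Braid :: "'o \<Rightarrow> 'o \<Rightarrow> 'm"  ("\<c>\<index>")

locale braided_monoidal_category = monoidal_category M
  for M :: "('o, 'm, 'z) brmoncat_scheme" (structure) +
  assumes Braid_Hom: "\<lbrakk>X \<in> Obj M; Y \<in> Obj M\<rbrakk> \<Longrightarrow> \<c> X Y \<in> Hom M (X \<otimes>\<^sub>o Y) (Y \<otimes>\<^sub>o X)"
    and Braid_iso: "\<lbrakk>X \<in> Obj M; Y \<in> Obj M\<rbrakk> \<Longrightarrow> is_iso M (\<c> X Y)"
    and Braid_natural: "\<lbrakk>f \<in> Hom M X X'; g \<in> Hom M Y Y'\<rbrakk>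
      \<Longrightarrow> \<c> X' Y' \<cdot> (f \<otimes>\<^sub>a g) = (g \<otimes>\<^sub>a f) \<cdot> \<c> X Y"
    and hexagon1: "\<lbrakk>X \<in> Obj M; Y \<in> Obj M; Z \<in> Obj M\<rbrakk>
      \<Longrightarrow> \<a> Y Z X \<cdot> \<c> X (Y \<otimes>\<^sub>o Z) \<cdot> \<a> X Y Z
        = (\<iota> Y \<otimes>\<^sub>a \<c> X Z) \<cdot> \<a> Y X Z \<cdot> (\<c> X Y \<otimes>\<^sub>a \<iota> Z)"
    and hexagon2: "\<lbrakk>X \<in> Obj M; Y \<in> Obj M; Z \<in> Obj M\<rbrakk>
      \<Longrightarrow> Inv M (\<a> Z X Y) \<cdot> \<c> (X \<otimes>\<^sub>o Y) Z \<cdot> Inv M (\<a> X Y Z)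
        = (\<c> X Z \<otimes>\<^sub>a \<iota> Y) \<cdot> Inv M (\<a> X Z Y) \<cdot> (\<iota> X \<otimes>\<^sub>a \<c> Y Z)"

record ('o, 'm) preadd_brmoncat = "('o, 'm) brmoncat" +
  Add :: "'m \<Rightarrow> 'm \<Rightarrow> 'm"  (infixl "\<oplus>\<index>" 65)
  Zero :: "'o \<Rightarrow> 'o \<Rightarrow> 'm"

locale preadditive_category = category M
  for M :: "('o, 'm, 'z) preadd_brmoncat_scheme" (structure) +
  assumes Hom_comm_group: "\<lbrakk>X \<in> Obj M; Y \<in> Obj M\<rbrakk>
      \<Longrightarrow> comm_group \<lparr>carrier = Hom M X Y, monoid.mult = Add M, one = Zero M X Y\<rparr>"
    and Cmp_Add_left: "\<lbrakk>f \<in> Hom M X Y; g \<in> Hom M Y Z; g' \<in> Hom M Y Z\<rbrakk>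
      \<Longrightarrow> (g \<oplus> g') \<cdot> f = g \<cdot> f \<oplus> g' \<cdot> f"
    and Cmp_Add_right: "\<lbrakk>f \<in> Hom M X Y; f' \<in> Hom M X Y; g \<in> Hom M Y Z\<rbrakk>
      \<Longrightarrow> g \<cdot> (f \<oplus> f') = g \<cdot> f \<oplus> g \<cdot> f'"

definition additive_functor :: "('o1, 'm1, 'y) preadd_brmoncat_scheme
    \<Rightarrow> ('o2, 'm2, 'z) preadd_brmoncat_scheme \<Rightarrow> ('o1, 'm1, 'o2, 'm2) ftor \<Rightarrow> bool" where
  "additive_functor C D F \<longleftrightarrow> is_functor C D F
     \<and> (\<forall>f \<in> Arr C. \<forall>g \<in> Hom C (Dom C f) (Cod C f).
           on_arr F (f \<oplus>\<^bsub>C\<^esub> g) = on_arr F f \<oplus>\<^bsub>D\<^esub> on_arr F g)"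

definition tensor_left :: "('o, 'm, 'z) moncat_scheme \<Rightarrow> 'o \<Rightarrow> ('o, 'm, 'o, 'm) ftor" where
  "tensor_left M X = Ftor (\<lambda>Y. X \<otimes>\<^sub>o Y) (\<lambda>f. \<iota> X \<otimes>\<^sub>a f)" for M (structure)

definition tensor_right :: "('o, 'm, 'z) moncat_scheme \<Rightarrow> 'o \<Rightarrow> ('o, 'm, 'o, 'm) ftor" where
  "tensor_right M X = Ftor (\<lambda>Y. Y \<otimes>\<^sub>o X) (\<lambda>f. f \<otimes>\<^sub>a \<iota> X)" for M (structure)


section \<open>Algebras, coalgebras, and their braided versions\<close>

text \<open>Equations that are usually written without associativity constraints are made precise by
  inserting \<open>\<a>\<close> and its inverse; by coherence the choice of bracketing is immaterial.\<close>

definition is_algebra :: "('o, 'm, 'z) moncat_scheme \<Rightarrow> 'o \<Rightarrow> 'm \<Rightarrow> 'm \<Rightarrow> bool" where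
  "is_algebra M A m u \<longleftrightarrow>
     A \<in> Obj M \<and> m \<in> Hom M (A \<otimes>\<^sub>o A) A \<and> u \<in> Hom M \<I> A
     \<and> m \<cdot> (m \<otimes>\<^sub>a \<iota> A) = m \<cdot> (\<iota> A \<otimes>\<^sub>a m) \<cdot> \<a> A A A
     \<and> m \<cdot> (u \<otimes>\<^sub>a \<iota> A) = \<l> A
     \<and> m \<cdot> (\<iota> A \<otimes>\<^sub>a u) = \<r> A" for M (structure)

definition is_coalgebra :: "('o, 'm, 'z) moncat_scheme \<Rightarrow> 'o \<Rightarrow> 'm \<Rightarrow> 'm \<Rightarrow> bool" where
  "is_coalgebra M C \<Delta> \<epsilon> \<longleftrightarrow>
     C \<in> Obj M \<and> \<Delta> \<in> Hom M C (C \<otimes>\<^sub>o C) \<and> \<epsilon> \<in> Hom M C \<I>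
     \<and> \<a> C C C \<cdot> (\<Delta> \<otimes>\<^sub>a \<iota> C) \<cdot> \<Delta> = (\<iota> C \<otimes>\<^sub>a \<Delta>) \<cdot> \<Delta>
     \<and> \<l> C \<cdot> (\<epsilon> \<otimes>\<^sub>a \<iota> C) \<cdot> \<Delta> = \<iota> C
     \<and> \<r> C \<cdot> (\<iota> C \<otimes>\<^sub>a \<epsilon>) \<cdot> \<Delta> = \<iota> C" for M (structure)

definition algebra_morphism :: "('o, 'm, 'z) moncat_scheme
    \<Rightarrow> 'o \<Rightarrow> 'm \<Rightarrow> 'm \<Rightarrow> 'o \<Rightarrow> 'm \<Rightarrow> 'm \<Rightarrow> 'm \<Rightarrow> bool" where
  "algebra_morphism M A m u A' m' u' f \<longleftrightarrow>
     f \<in> Hom M A A' \<and> f \<cdot> m = m' \<cdot> (f \<otimes>\<^sub>a f) \<and> f \<cdot> u = u'" for M (structure)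

definition coalgebra_morphism :: "('o, 'm, 'z) moncat_scheme
    \<Rightarrow> 'o \<Rightarrow> 'm \<Rightarrow> 'm \<Rightarrow> 'o \<Rightarrow> 'm \<Rightarrow> 'm \<Rightarrow> 'm \<Rightarrow> bool" where
  "coalgebra_morphism M C \<Delta> \<epsilon> C' \<Delta>' \<epsilon>' f \<longleftrightarrow>
     f \<in> Hom M C C' \<and> \<Delta>' \<cdot> f = (f \<otimes>\<^sub>a f) \<cdot> \<Delta> \<and> \<epsilon>' \<cdot> f = \<epsilon>" for M (structure)

text \<open>For \<open>c : V \<otimes> V \<rightarrow> V \<otimes> V\<close>, the arrow \<open>V \<otimes> c \<otimes> V\<close> on \<open>(V \<otimes> V) \<otimes> (V \<otimes> V)\<close>.\<close>

definition mid :: "('o, 'm, 'z) moncat_scheme \<Rightarrow> 'o \<Rightarrow> 'm \<Rightarrow> 'm" where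
  "mid M V c = Inv M (\<a> V V (V \<otimes>\<^sub>o V))
     \<cdot> (\<iota> V \<otimes>\<^sub>a (\<a> V V V \<cdot> (c \<otimes>\<^sub>a \<iota> V) \<cdot> Inv M (\<a> V V V)))
     \<cdot> \<a> V V (V \<otimes>\<^sub>o V)" for M (structure)

definition is_braided_object :: "('o, 'm, 'z) moncat_scheme \<Rightarrow> 'o \<Rightarrow> 'm \<Rightarrow> bool" where
  "is_braided_object M V c \<longleftrightarrow>
     V \<in> Obj M \<and> c \<in> Hom M (V \<otimes>\<^sub>o V) (V \<otimes>\<^sub>o V) \<and> is_iso M c
     \<and> (let cV = c \<otimes>\<^sub>a \<iota> V; Vc = Inv M (\<a> V V V) \<cdot> (\<iota> V \<otimes>\<^sub>a c) \<cdot> \<a> V V V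
        in cV \<cdot> Vc \<cdot> cV = Vc \<cdot> cV \<cdot> Vc)" for M (structure)

definition braided_object_morphism :: "('o, 'm, 'z) moncat_scheme
    \<Rightarrow> 'o \<Rightarrow> 'm \<Rightarrow> 'o \<Rightarrow> 'm \<Rightarrow> 'm \<Rightarrow> bool" where
  "braided_object_morphism M V c V' c' f \<longleftrightarrow>
     f \<in> Hom M V V' \<and> c' \<cdot> (f \<otimes>\<^sub>a f) = (f \<otimes>\<^sub>a f) \<cdot> c" for M (structure)

definition is_braided_algebra :: "('o, 'm, 'z) moncat_scheme \<Rightarrow> 'o \<Rightarrow> 'm \<Rightarrow> 'm \<Rightarrow> 'm \<Rightarrow> bool" where
  "is_braided_algebra M A m u c \<longleftrightarrow>
     is_algebra M A m u \<and> is_braided_object M A c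
     \<and> c \<cdot> (m \<otimes>\<^sub>a \<iota> A)
         = (\<iota> A \<otimes>\<^sub>a m) \<cdot> \<a> A A A \<cdot> (c \<otimes>\<^sub>a \<iota> A) \<cdot> Inv M (\<a> A A A) \<cdot> (\<iota> A \<otimes>\<^sub>a c) \<cdot> \<a> A A A
     \<and> c \<cdot> (\<iota> A \<otimes>\<^sub>a m)
         = (m \<otimes>\<^sub>a \<iota> A) \<cdot> Inv M (\<a> A A A) \<cdot> (\<iota> A \<otimes>\<^sub>a c) \<cdot> \<a> A A A \<cdot> (c \<otimes>\<^sub>a \<iota> A) \<cdot> Inv M (\<a> A A A)
     \<and> c \<cdot> (u \<otimes>\<^sub>a \<iota> A) \<cdot> Inv M (\<l> A) = (\<iota> A \<otimes>\<^sub>a u) \<cdot> Inv M (\<r> A)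
     \<and> c \<cdot> (\<iota> A \<otimes>\<^sub>a u) \<cdot> Inv M (\<r> A) = (u \<otimes>\<^sub>a \<iota> A) \<cdot> Inv M (\<l> A)" for M (structure)

definition is_braided_coalgebra :: "('o, 'm, 'z) moncat_scheme \<Rightarrow> 'o \<Rightarrow> 'm \<Rightarrow> 'm \<Rightarrow> 'm \<Rightarrow> bool" where
  "is_braided_coalgebra M C \<Delta> \<epsilon> c \<longleftrightarrow>
     is_coalgebra M C \<Delta> \<epsilon> \<and> is_braided_object M C c
     \<and> (\<Delta> \<otimes>\<^sub>a \<iota> C) \<cdot> c
         = Inv M (\<a> C C C) \<cdot> (\<iota> C \<otimes>\<^sub>a c) \<cdot> \<a> C C C \<cdot> (c \<otimes>\<^sub>a \<iota> C) \<cdot> Inv M (\<a> C C C) \<cdot> (\<iota> C \<otimes>\<^sub>a \<Delta>)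
     \<and> (\<iota> C \<otimes>\<^sub>a \<Delta>) \<cdot> c
         = \<a> C C C \<cdot> (c \<otimes>\<^sub>a \<iota> C) \<cdot> Inv M (\<a> C C C) \<cdot> (\<iota> C \<otimes>\<^sub>a c) \<cdot> \<a> C C C \<cdot> (\<Delta> \<otimes>\<^sub>a \<iota> C)
     \<and> \<l> C \<cdot> (\<epsilon> \<otimes>\<^sub>a \<iota> C) \<cdot> c = \<r> C \<cdot> (\<iota> C \<otimes>\<^sub>a \<epsilon>)
     \<and> \<r> C \<cdot> (\<iota> C \<otimes>\<^sub>a \<epsilon>) \<cdot> c = \<l> C \<cdot> (\<epsilon> \<otimes>\<^sub>a \<iota> C)" for M (structure)

definition is_braided_bialgebra :: "('o, 'm, 'z) moncat_scheme
    \<Rightarrow> 'o \<Rightarrow> 'm \<Rightarrow> 'm \<Rightarrow> 'm \<Rightarrow> 'm \<Rightarrow> 'm \<Rightarrow> bool" where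
  "is_braided_bialgebra M B m u \<Delta> \<epsilon> c \<longleftrightarrow>
     is_braided_algebra M B m u c \<and> is_braided_coalgebra M B \<Delta> \<epsilon> c
     \<and> \<Delta> \<cdot> m = (m \<otimes>\<^sub>a m) \<cdot> mid M B c \<cdot> (\<Delta> \<otimes>\<^sub>a \<Delta>)
     \<and> \<Delta> \<cdot> u = (u \<otimes>\<^sub>a u) \<cdot> Inv M (\<l> \<I>)
     \<and> \<epsilon> \<cdot> m = \<l> \<I> \<cdot> (\<epsilon> \<otimes>\<^sub>a \<epsilon>)
     \<and> \<epsilon> \<cdot> u = \<iota> \<I>" for M (structure)

definition is_bialgebra :: "('o, 'm, 'z) brmoncat_scheme
    \<Rightarrow> 'o \<Rightarrow> 'm \<Rightarrow> 'm \<Rightarrow> 'm \<Rightarrow> 'm \<Rightarrow> bool" where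
  "is_bialgebra M B m u \<Delta> \<epsilon> \<longleftrightarrow>
     is_algebra M B m u \<and> is_coalgebra M B \<Delta> \<epsilon>
     \<and> algebra_morphism M B m u
         (B \<otimes>\<^sub>o B) ((m \<otimes>\<^sub>a m) \<cdot> mid M B (\<c> B B)) ((u \<otimes>\<^sub>a u) \<cdot> Inv M (\<l> \<I>)) \<Delta>
     \<and> algebra_morphism M B m u \<I> (\<l> \<I>) (\<iota> \<I>) \<epsilon>" for M (structure)


section \<open>The categories of braided objects, bialgebras and braided bialgebras\<close>

datatype ('o, 'm) brobj = BrObj (br_obj: 'o) (br_braid: 'm)

datatype ('o, 'm) bialg =
  Bialg (bi_obj: 'o) (bi_mult: 'm) (bi_unit: 'm) (bi_comult: 'm) (bi_counit: 'm)

datatype ('o, 'm) brbialg =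
  BrBialg (bb_obj: 'o) (bb_mult: 'm) (bb_unit: 'm) (bb_comult: 'm) (bb_counit: 'm) (bb_braid: 'm)

text \<open>An arrow between structured objects records its source and target, so that domain and
  codomain are functions of the arrow.\<close>

datatype ('x, 'm) sarr = SArr (sa_src: 'x) (sa_arr: 'm) (sa_tgt: 'x)

definition structured_cat :: "('o, 'm, 'z) cat_scheme \<Rightarrow> 'x set \<Rightarrow> ('x \<Rightarrow> 'o)
    \<Rightarrow> ('x \<Rightarrow> 'x \<Rightarrow> 'm \<Rightarrow> bool) \<Rightarrow> ('x, ('x, 'm) sarr) cat" where
  "structured_cat M S U R =
     \<lparr>Obj = S,
      Arr = {SArr X f Y | X f Y. X \<in> S \<and> Y \<in> S \<and> R X Y f},
      Dom = sa_src,
      Cod = sa_tgt,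
      Idt = (\<lambda>X. SArr X (\<iota> (U X)) X),
      Cmp = (\<lambda>g f. SArr (sa_src f) (sa_arr g \<cdot> sa_arr f) (sa_tgt g))\<rparr>" for M (structure)

definition Br_cat :: "('o, 'm, 'z) moncat_scheme
    \<Rightarrow> (('o, 'm) brobj, (('o, 'm) brobj, 'm) sarr) cat" where
  "Br_cat M = structured_cat M {V. is_braided_object M (br_obj V) (br_braid V)} br_obj
     (\<lambda>V W. braided_object_morphism M (br_obj V) (br_braid V) (br_obj W) (br_braid W))"

definition Bialg_cat :: "('o, 'm, 'z) brmoncat_scheme
    \<Rightarrow> (('o, 'm) bialg, (('o, 'm) bialg, 'm) sarr) cat" where
  "Bialg_cat M = structured_cat M
     {B. is_bialgebra M (bi_obj B) (bi_mult B) (bi_unit B) (bi_comult B) (bi_counit B)}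
     bi_obj
     (\<lambda>B B' f. algebra_morphism M (bi_obj B) (bi_mult B) (bi_unit B)
                 (bi_obj B') (bi_mult B') (bi_unit B') f
       \<and> coalgebra_morphism M (bi_obj B) (bi_comult B) (bi_counit B)
                 (bi_obj B') (bi_comult B') (bi_counit B') f)"

definition BrBialg_cat :: "('o, 'm, 'z) moncat_scheme
    \<Rightarrow> (('o, 'm) brbialg, (('o, 'm) brbialg, 'm) sarr) cat" where
  "BrBialg_cat M = structured_cat M
     {B. is_braided_bialgebra M (bb_obj B) (bb_mult B) (bb_unit B)
           (bb_comult B) (bb_counit B) (bb_braid B)}
     bb_obj
     (\<lambda>B B' f. algebra_morphism M (bb_obj B) (bb_mult B) (bb_unit B)
                 (bb_obj B') (bb_mult B') (bb_unit B') f
       \<and> coalgebra_morphism M (bb_obj B) (bb_comult B) (bb_counit B)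
                 (bb_obj B') (bb_comult B') (bb_counit B') f
       \<and> braided_object_morphism M (bb_obj B) (bb_braid B) (bb_obj B') (bb_braid B') f)"

definition forget_Br :: "(('o, 'm) brobj, (('o, 'm) brobj, 'm) sarr, 'o, 'm) ftor" where
  "forget_Br = Ftor br_obj sa_arr"

definition forget_Bialg :: "(('o, 'm) bialg, (('o, 'm) bialg, 'm) sarr, 'o, 'm) ftor" where
  "forget_Bialg = Ftor bi_obj sa_arr"

definition underlying_Br :: "('o, 'm) brbialg \<Rightarrow> ('o, 'm) brobj" where
  "underlying_Br A = BrObj (bb_obj A) (bb_braid A)"

definition forget_BrBialg_Br ::
  "(('o, 'm) brbialg, (('o, 'm) brbialg, 'm) sarr, ('o, 'm) brobj, (('o, 'm) brobj, 'm) sarr) ftor"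
  where
  "forget_BrBialg_Br = Ftor underlying_Br
     (\<lambda>f. SArr (underlying_Br (sa_src f)) (sa_arr f) (underlying_Br (sa_tgt f)))"

definition J_obj :: "('o, 'm, 'z) brmoncat_scheme \<Rightarrow> 'o \<Rightarrow> ('o, 'm) brobj" where
  "J_obj M V = BrObj V (\<c> V V)" for M (structure)

definition J :: "('o, 'm, 'z) brmoncat_scheme
    \<Rightarrow> ('o, 'm, ('o, 'm) brobj, (('o, 'm) brobj, 'm) sarr) ftor" where
  "J M = Ftor (J_obj M) (\<lambda>f. SArr (J_obj M (Dom M f)) f (J_obj M (Cod M f)))"

definition J_Bialg_obj :: "('o, 'm, 'z) brmoncat_scheme \<Rightarrow> ('o, 'm) bialg \<Rightarrow> ('o, 'm) brbialg" where
  "J_Bialg_obj M B = BrBialg (bi_obj B) (bi_mult B) (bi_unit B) (bi_comult B) (bi_counit B)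
     (\<c> (bi_obj B) (bi_obj B))" for M (structure)

definition J_Bialg :: "('o, 'm, 'z) brmoncat_scheme \<Rightarrow> (('o, 'm) bialg, (('o, 'm) bialg, 'm) sarr,
    ('o, 'm) brbialg, (('o, 'm) brbialg, 'm) sarr) ftor" where
  "J_Bialg M = Ftor (J_Bialg_obj M)
     (\<lambda>f. SArr (J_Bialg_obj M (sa_src f)) (sa_arr f) (J_Bialg_obj M (sa_tgt f)))"


section \<open>The primitive functors\<close>

text \<open>Throughout, \<open>\<xi>\<close> assigns to each braided bialgebra \<open>A\<close> the chosen equalizer
  \<open>\<xi> A : P(A) \<rightarrow> A\<close>; in particular \<open>P(A)\<close> is the domain of \<open>\<xi> A\<close>.\<close>

definition primitive_choice ::
  "('o, 'm, 'z) preadd_brmoncat_scheme \<Rightarrow> (('o, 'm) brbialg \<Rightarrow> 'm) \<Rightarrow> bool" where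
  "primitive_choice M \<xi> \<longleftrightarrow> (\<forall>A \<in> Obj (BrBialg_cat M).
     is_equalizer M (\<xi> A) (bb_comult A)
       ((\<iota> (bb_obj A) \<otimes>\<^sub>a bb_unit A) \<cdot> Inv M (\<r> (bb_obj A))
        \<oplus> (bb_unit A \<otimes>\<^sub>a \<iota> (bb_obj A)) \<cdot> Inv M (\<l> (bb_obj A))))" for M (structure)

definition P_braid :: "('o, 'm, 'z) moncat_scheme \<Rightarrow> (('o, 'm) brbialg \<Rightarrow> 'm)
    \<Rightarrow> ('o, 'm) brbialg \<Rightarrow> 'm" where
  "P_braid M \<xi> A = (let P = Dom M (\<xi> A) in
     THE c. c \<in> Hom M (P \<otimes>\<^sub>o P) (P \<otimes>\<^sub>o P) \<and> (\<xi> A \<otimes>\<^sub>a \<xi> A) \<cdot> c = bb_braid A \<cdot> (\<xi> A \<otimes>\<^sub>a \<xi> A))"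
  for M (structure)

definition P_Br_obj :: "('o, 'm, 'z) moncat_scheme \<Rightarrow> (('o, 'm) brbialg \<Rightarrow> 'm)
    \<Rightarrow> ('o, 'm) brbialg \<Rightarrow> ('o, 'm) brobj" where
  "P_Br_obj M \<xi> A = BrObj (Dom M (\<xi> A)) (P_braid M \<xi> A)"

definition P_Br :: "('o, 'm, 'z) moncat_scheme \<Rightarrow> (('o, 'm) brbialg \<Rightarrow> 'm)
    \<Rightarrow> (('o, 'm) brbialg, (('o, 'm) brbialg, 'm) sarr, ('o, 'm) brobj, (('o, 'm) brobj, 'm) sarr) ftor"
  where
  "P_Br M \<xi> = Ftor (P_Br_obj M \<xi>)
     (\<lambda>f. SArr (P_Br_obj M \<xi> (sa_src f))
            (THE h. h \<in> Hom M (Dom M (\<xi> (sa_src f))) (Dom M (\<xi> (sa_tgt f)))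
                    \<and> \<xi> (sa_tgt f) \<cdot> h = sa_arr f \<cdot> \<xi> (sa_src f))
            (P_Br_obj M \<xi> (sa_tgt f)))" for M (structure)

definition P_functor :: "('o, 'm, 'z) brmoncat_scheme \<Rightarrow> (('o, 'm) brbialg \<Rightarrow> 'm)
    \<Rightarrow> (('o, 'm) bialg, (('o, 'm) bialg, 'm) sarr, 'o, 'm) ftor" where
  "P_functor M \<xi> = forget_Br \<circ>\<^sub>F P_Br M \<xi> \<circ>\<^sub>F J_Bialg M"

text \<open>The natural transformation \<open>\<xi>\<close> from \<open>P_Br\<close> to the forgetful functor into braided objects,
  and its counterpart from \<open>P\<close> to the forgetful functor on bialgebras, given by the same chosen
  equalizers.\<close>

definition xi_BrBialg :: "('o, 'm, 'z) moncat_scheme \<Rightarrow> (('o, 'm) brbialg \<Rightarrow> 'm)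
    \<Rightarrow> (('o, 'm) brbialg, (('o, 'm) brbialg, 'm) sarr, ('o, 'm) brobj, (('o, 'm) brobj, 'm) sarr) ntrans"
  where
  "xi_BrBialg M \<xi> = NTrans (P_Br M \<xi>) forget_BrBialg_Br
     (\<lambda>A. SArr (P_Br_obj M \<xi> A) (\<xi> A) (underlying_Br A))"

definition xi_Bialg :: "('o, 'm, 'z) brmoncat_scheme \<Rightarrow> (('o, 'm) brbialg \<Rightarrow> 'm)
    \<Rightarrow> (('o, 'm) bialg, (('o, 'm) bialg, 'm) sarr, 'o, 'm) ntrans" where
  "xi_Bialg M \<xi> = NTrans (P_functor M \<xi>) forget_Bialg (\<lambda>B. \<xi> (J_Bialg_obj M B))"

end

(* By the hexagons and naturality, the ambient braiding turns every bialgebra B into a braided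
   bialgebra; the unit axioms rest on l c_{A,1} = r and r c_{1,A} = l, which follow from Kelly's unit
   coherences. As tensoring preserves equalizers, xi (x) xi is a monomorphism. By naturality of the
   braiding, c_{P(B),P(B)} solves the equation that defines the braiding of P_Br, so the two agree;
   all other components of the two functors and of the two natural transformations coincide. *)

theory Submission
  imports Defs
begin

section \<open>Unit coherence in monoidal categories\<close>

text \<open>\<open>functor_eq\<close> and \<open>ntrans_eq\<close> demand more than equal values:
  both sides must be functors, or natural transformations. These laws are proved on the side where
  they decompose, namely for \<open>J M\<close> after \<open>P_functor M \<xi>\<close> and for
  \<open>J M\<close> whiskered with \<open>xi_Bialg M \<xi>\<close>, and are then transported to the
  other side along the pointwise equalities. The laws for P itself are instances of uniqueness of
  lifts through equalizers. The same uniqueness gives meaning to the definite description in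
  \<open>P_Br\<close> on arrows. The category is not strict, so every equation carries its
  associators. The simp rules bring a composite to a normal form: nested to the right, adjacent
  tensor products fused, inverses cancelled. Each coherence, hexagon or naturality equation is
  applied by hand at the place where it is wanted, and simp does the regrouping in between.\<close>

lemma Hom_iff: "f \<in> Hom C X Y \<longleftrightarrow> f \<in> Arr C \<and> Dom C f = X \<and> Cod C f = Y"
  by (simp add: Hom_def)

section \<open>Composites, inverses and equalizers in a category\<close>

context category
begin

lemma Dom_in_Obj [simp]: "f \<in> Arr C \<Longrightarrow> Dom C f \<in> Obj C"
  by (rule Dom_Obj)

lemma Cod_in_Obj [simp]: "f \<in> Arr C \<Longrightarrow> Cod C f \<in> Obj C"
  by (rule Cod_Obj)

lemma Hom_Obj: "f \<in> Hom C X Y \<Longrightarrow> X \<in> Obj C \<and> Y \<in> Obj C"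
  by (auto simp: Hom_iff)

lemma Idt_simps [simp]:
  assumes "X \<in> Obj C"
  shows "\<iota> X \<in> Arr C" "Dom C (\<iota> X) = X" "Cod C (\<iota> X) = X"
  using Idt_Hom[OF assms] by (auto simp: Hom_iff)

lemma Cmp_simps [simp]:
  assumes "f \<in> Arr C" "g \<in> Arr C" "Cod C f = Dom C g"
  shows "g \<cdot> f \<in> Arr C" "Dom C (g \<cdot> f) = Dom C f" "Cod C (g \<cdot> f) = Cod C g"
  using Cmp_Hom[of f "Dom C f" "Cod C f" g "Cod C g"] assms by (auto simp: Hom_iff)

lemma Cmp_Idt_simps [simp]:
  assumes "f \<in> Arr C"
  shows "Cod C f = Y \<Longrightarrow> \<iota> Y \<cdot> f = f" "Dom C f = X \<Longrightarrow> f \<cdot> \<iota> X = f"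
  using assms Cmp_Idt_left Cmp_Idt_right by (auto simp: Hom_iff)

lemma Cmp_assoc_simp [simp]:
  assumes "f \<in> Arr C" "g \<in> Arr C" "h \<in> Arr C" "Cod C f = Dom C g" "Cod C g = Dom C h"
  shows "(h \<cdot> g) \<cdot> f = h \<cdot> (g \<cdot> f)"
  using assms Cmp_assoc[of f "Dom C f" "Dom C g" g "Dom C h" h "Cod C h"] by (auto simp: Hom_iff)

text \<open>In a composite nested to the right, \<open>g \<cdot> f\<close> is no longer a subterm
  once another arrow is applied first. This is the form in which a known equation between two
  adjacent arrows can still be used there.\<close>

lemma Cmp_reassoc:
  assumes "g \<cdot> f = h" "f \<in> Arr C" "g \<in> Arr C" "k \<in> Arr C" "Cod C f = Dom C g" "Cod C k = Dom C f"
  shows "g \<cdot> (f \<cdot> k) = h \<cdot> k"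
  using assms by (metis Cmp_assoc_simp)

lemma is_inverse_unique:
  assumes "is_inverse C f g" "is_inverse C f h"
  shows "g = h"
proof -
  have T: "f \<in> Arr C" "g \<in> Arr C" "h \<in> Arr C" "Cod C g = Dom C f" "Dom C g = Cod C f"
      "Dom C h = Cod C f" "Cod C h = Dom C f"
    and E: "g \<cdot> f = \<iota> (Dom C f)" "f \<cdot> h = \<iota> (Cod C f)"
    using assms by (auto simp: is_inverse_def Hom_iff)
  have "g = g \<cdot> (f \<cdot> h)"
    using T E(2) by simp
  also have "\<dots> = (g \<cdot> f) \<cdot> h"
    using T by simp
  also have "\<dots> = h"
    unfolding E(1) using T by simp
  finally show ?thesis .
qed

lemma Inv_eq: "is_inverse C f g \<Longrightarrow> Inv C f = g"
  unfolding Inv_def using is_inverse_unique by blast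

lemma is_inverse_Inv: "is_iso C f \<Longrightarrow> is_inverse C f (Inv C f)"
  using Inv_eq by (auto simp: is_iso_def)

lemma is_iso_Arr: "is_iso C f \<Longrightarrow> f \<in> Arr C"
  by (auto simp: is_iso_def is_inverse_def)

lemma Inv_simps [simp]:
  assumes "is_iso C f"
  shows "Inv C f \<in> Arr C" "Dom C (Inv C f) = Cod C f" "Cod C (Inv C f) = Dom C f"
    "Inv C f \<cdot> f = \<iota> (Dom C f)" "f \<cdot> Inv C f = \<iota> (Cod C f)"
  using is_inverse_Inv[OF assms] by (auto simp: is_inverse_def Hom_iff)

lemma Inv_cancel [simp]:
  assumes "is_iso C f" "k \<in> Arr C"
  shows "Cod C k = Dom C f \<Longrightarrow> Inv C f \<cdot> (f \<cdot> k) = k"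
    "Cod C k = Cod C f \<Longrightarrow> f \<cdot> (Inv C f \<cdot> k) = k"
  using assms is_iso_Arr[OF assms(1)]
  by (metis Cmp_Idt_simps(1) Cmp_assoc_simp Inv_simps)+

lemma iso_cancel_left:
  assumes "is_iso C f" "h \<in> Arr C" "k \<in> Arr C" "Cod C h = Dom C f" "Cod C k = Dom C f"
    and "f \<cdot> h = f \<cdot> k"
  shows "h = k"
  by (metis assms Inv_cancel(1))

lemma iso_cancel_right:
  assumes "is_iso C f" "h \<in> Arr C" "k \<in> Arr C" "Dom C h = Cod C f" "Dom C k = Cod C f"
    and "h \<cdot> f = k \<cdot> f"
  shows "h = k"
proof -
  have "h = (h \<cdot> f) \<cdot> Inv C f"
    using assms(1-5) is_iso_Arr[OF assms(1)] by simp
  also have "\<dots> = k"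
    unfolding assms(6) using assms(1-5) is_iso_Arr[OF assms(1)] by simp
  finally show ?thesis .
qed

lemma is_iso_Cmp:
  assumes "is_iso C f" "is_iso C g" "Cod C f = Dom C g"
  shows "is_iso C (g \<cdot> f)"
proof -
  have "is_inverse C (g \<cdot> f) (Inv C f \<cdot> Inv C g)"
    using assms is_iso_Arr[OF assms(1)] is_iso_Arr[OF assms(2)]
    by (simp add: is_inverse_def Hom_iff)
  then show ?thesis
    by (auto simp: is_iso_def)
qed

lemma equalizer_Hom:
  assumes "is_equalizer C e f g"
  shows "e \<in> Arr C" "f \<in> Arr C" "g \<in> Arr C" "Cod C e = Dom C f" "Dom C g = Dom C f" "Cod C g = Cod C f"
    "f \<cdot> e = g \<cdot> e"
  using assms by (auto simp: is_equalizer_def Hom_iff)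

lemma equalizer_factor:
  assumes "is_equalizer C e f g" "h \<in> Arr C" "Cod C h = Dom C f" "f \<cdot> h = g \<cdot> h"
  shows "\<exists>!k. k \<in> Hom C (Dom C h) (Dom C e) \<and> e \<cdot> k = h"
  using assms by (auto simp: is_equalizer_def)

text \<open>The arrow \<open>e \<cdot> h\<close> equalizes the pair, so it factors uniquely through
  \<open>e\<close>; both \<open>h\<close> and \<open>k\<close> are such factorizations.\<close>

lemma equalizer_mono:
  assumes e: "is_equalizer C e f g" and h: "h \<in> Hom C X (Dom C e)" and k: "k \<in> Hom C X (Dom C e)"
    and eq: "e \<cdot> h = e \<cdot> k"
  shows "h = k"
proof -
  note E = equalizer_Hom[OF e]
  have "f \<cdot> (e \<cdot> h) = g \<cdot> (e \<cdot> h)"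
    using Cmp_reassoc[OF E(7), of h] h E by (simp add: Hom_iff)
  then have "\<exists>!j. j \<in> Hom C (Dom C (e \<cdot> h)) (Dom C e) \<and> e \<cdot> j = e \<cdot> h"
    using h E by (intro equalizer_factor[OF e]) (auto simp: Hom_iff)
  moreover have "Dom C (e \<cdot> h) = X"
    using h E by (auto simp: Hom_iff)
  ultimately show ?thesis
    using h k eq by auto
qed

end

section \<open>The interchange law and Kelly's unit coherences\<close>

context monoidal_category
begin

lemma TensO_simp [simp]: "X \<in> Obj M \<Longrightarrow> Y \<in> Obj M \<Longrightarrow> X \<otimes>\<^sub>o Y \<in> Obj M"
  by (rule TensO_Obj)

lemma UnitO_simp [simp]: "\<I> \<in> Obj M"
  by (rule UnitO_Obj)

lemma TensA_simps [simp]: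
  assumes "f \<in> Arr M" "g \<in> Arr M"
  shows "f \<otimes>\<^sub>a g \<in> Arr M" "Dom M (f \<otimes>\<^sub>a g) = Dom M f \<otimes>\<^sub>o Dom M g" "Cod M (f \<otimes>\<^sub>a g) = Cod M f \<otimes>\<^sub>o Cod M g"
  using TensA_Hom[of f "Dom M f" "Cod M f" g "Dom M g" "Cod M g"] assms by (auto simp: Hom_iff)

lemma TensA_Idt_simp [simp]: "X \<in> Obj M \<Longrightarrow> Y \<in> Obj M \<Longrightarrow> \<iota> X \<otimes>\<^sub>a \<iota> Y = \<iota> (X \<otimes>\<^sub>o Y)"
  by (rule TensA_Idt)

text \<open>Oriented towards fusing: adjacent tensor products become one, so that an equation in a
  single slot can be used by rewriting inside that slot.\<close>

lemma TensA_interchange [simp]: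
  assumes "f \<in> Arr M" "f' \<in> Arr M" "g \<in> Arr M" "g' \<in> Arr M" "Cod M f = Dom M f'" "Cod M g = Dom M g'"
  shows "(f' \<otimes>\<^sub>a g') \<cdot> (f \<otimes>\<^sub>a g) = (f' \<cdot> f) \<otimes>\<^sub>a (g' \<cdot> g)"
  using assms
  by (intro TensA_Cmp[symmetric]) (auto simp: Hom_iff)

lemma TensA_interchange_reassoc [simp]:
  assumes "f \<in> Arr M" "f' \<in> Arr M" "g \<in> Arr M" "g' \<in> Arr M" "Cod M f = Dom M f'" "Cod M g = Dom M g'"
    "k \<in> Arr M" "Cod M k = Dom M f \<otimes>\<^sub>o Dom M g"
  shows "(f' \<otimes>\<^sub>a g') \<cdot> ((f \<otimes>\<^sub>a g) \<cdot> k) = ((f' \<cdot> f) \<otimes>\<^sub>a (g' \<cdot> g)) \<cdot> k"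
  using assms by (intro Cmp_reassoc) auto

lemma is_iso_Idt [simp]: "X \<in> Obj M \<Longrightarrow> is_iso M (\<iota> X)"
  by (auto simp: is_iso_def is_inverse_def Hom_iff intro!: exI[of _ "\<iota> X"])

lemma is_iso_TensA:
  assumes "is_iso M f" "is_iso M g"
  shows "is_iso M (f \<otimes>\<^sub>a g)"
proof -
  have "is_inverse M (f \<otimes>\<^sub>a g) (Inv M f \<otimes>\<^sub>a Inv M g)"
    using assms is_iso_Arr[OF assms(1)] is_iso_Arr[OF assms(2)]
    by (simp add: is_inverse_def Hom_iff)
  then show ?thesis
    by (auto simp: is_iso_def)
qed

lemma constraint_simps [simp]:
  assumes "X \<in> Obj M"
  shows "\<l> X \<in> Arr M" "Dom M (\<l> X) = \<I> \<otimes>\<^sub>o X" "Cod M (\<l> X) = X" "is_iso M (\<l> X)"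
    "\<r> X \<in> Arr M" "Dom M (\<r> X) = X \<otimes>\<^sub>o \<I>" "Cod M (\<r> X) = X" "is_iso M (\<r> X)"
  using assms LUnit_Hom RUnit_Hom LUnit_iso RUnit_iso by (auto simp: Hom_iff)

lemma Assoc_simps [simp]:
  assumes "X \<in> Obj M" "Y \<in> Obj M" "Z \<in> Obj M"
  shows "\<a> X Y Z \<in> Arr M" "Dom M (\<a> X Y Z) = (X \<otimes>\<^sub>o Y) \<otimes>\<^sub>o Z" "Cod M (\<a> X Y Z) = X \<otimes>\<^sub>o (Y \<otimes>\<^sub>o Z)"
    "is_iso M (\<a> X Y Z)"
  using assms Assoc_Hom Assoc_iso by (auto simp: Hom_iff)

text \<open>Naturality of the invertible \<open>\<l>\<close> recovers \<open>f\<close> from its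
  tensor product with the unit. This opens the way to the unit coherences: the pentagon and the
  triangle constrain the unit arrows only after a further tensoring.\<close>

lemma tensor_unit_left_faithful:
  assumes "f \<in> Hom M X Y" "g \<in> Hom M X Y" "\<iota> \<I> \<otimes>\<^sub>a f = \<iota> \<I> \<otimes>\<^sub>a g"
  shows "f = g"
proof -
  have "f \<cdot> \<l> X = g \<cdot> \<l> X"
    using LUnit_natural[OF assms(1)] LUnit_natural[OF assms(2)] assms(3) by simp
  then show ?thesis
    using assms Hom_Obj[OF assms(1)] by (intro iso_cancel_right[of "\<l> X" f g]) (auto simp: Hom_iff)
qed

lemma tensor_unit_right_faithful:
  assumes "f \<in> Hom M X Y" "g \<in> Hom M X Y" "f \<otimes>\<^sub>a \<iota> \<I> = g \<otimes>\<^sub>a \<iota> \<I>"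
  shows "f = g"
proof -
  have "f \<cdot> \<r> X = g \<cdot> \<r> X"
    using RUnit_natural[OF assms(1)] RUnit_natural[OF assms(2)] assms(3) by simp
  then show ?thesis
    using assms Hom_Obj[OF assms(1)] by (intro iso_cancel_right[of "\<r> X" f g]) (auto simp: Hom_iff)
qed

text \<open>After tensoring with the unit on the left, both sides can be compared through the
  pentagon for (1, 1, X, Y), the triangles for (1, X (x) Y) and (1, X), and naturality of the
  associator.\<close>

lemma LUnit_TensO:
  assumes X: "X \<in> Obj M" and Y: "Y \<in> Obj M"
  shows "\<l> (X \<otimes>\<^sub>o Y) \<cdot> \<a> \<I> X Y = \<l> X \<otimes>\<^sub>a \<iota> Y"
proof (rule tensor_unit_left_faithful)
  \<comment> \<open>The longer side of that pentagon without its last factor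
    \<open>\<iota> \<I> \<otimes>\<^sub>a \<a> \<I> X Y\<close>. It is invertible, so it can be
    cancelled at the end.\<close>
  let ?p = "\<a> \<I> (\<I> \<otimes>\<^sub>o X) Y \<cdot> (\<a> \<I> \<I> X \<otimes>\<^sub>a \<iota> Y)"
  note T = X Y
  have "(\<iota> \<I> \<otimes>\<^sub>a (\<l> (X \<otimes>\<^sub>o Y) \<cdot> \<a> \<I> X Y)) \<cdot> ?p
      = (\<iota> \<I> \<otimes>\<^sub>a \<l> (X \<otimes>\<^sub>o Y)) \<cdot> ((\<iota> \<I> \<otimes>\<^sub>a \<a> \<I> X Y) \<cdot> ?p)"
    using T by simp
  also have "(\<iota> \<I> \<otimes>\<^sub>a \<a> \<I> X Y) \<cdot> ?p = \<a> \<I> \<I> (X \<otimes>\<^sub>o Y) \<cdot> \<a> (\<I> \<otimes>\<^sub>o \<I>) X Y"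
    using pentagon[of \<I> \<I> X Y] T by simp
  also have "(\<iota> \<I> \<otimes>\<^sub>a \<l> (X \<otimes>\<^sub>o Y)) \<cdot> (\<a> \<I> \<I> (X \<otimes>\<^sub>o Y) \<cdot> \<a> (\<I> \<otimes>\<^sub>o \<I>) X Y)
      = (\<r> \<I> \<otimes>\<^sub>a \<iota> (X \<otimes>\<^sub>o Y)) \<cdot> \<a> (\<I> \<otimes>\<^sub>o \<I>) X Y"
    using T by (intro Cmp_reassoc triangle) auto
  also have "\<dots> = \<a> \<I> X Y \<cdot> ((\<r> \<I> \<otimes>\<^sub>a \<iota> X) \<otimes>\<^sub>a \<iota> Y)"
    using Assoc_natural[of "\<r> \<I>" "\<I> \<otimes>\<^sub>o \<I>" \<I> "\<iota> X" X X "\<iota> Y" Y Y] T by (simp add: Hom_iff)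
  also have "(\<r> \<I> \<otimes>\<^sub>a \<iota> X) \<otimes>\<^sub>a \<iota> Y = ((\<iota> \<I> \<otimes>\<^sub>a \<l> X) \<otimes>\<^sub>a \<iota> Y) \<cdot> (\<a> \<I> \<I> X \<otimes>\<^sub>a \<iota> Y)"
    using T triangle[of \<I> X] by simp
  also have "\<a> \<I> X Y \<cdot> (((\<iota> \<I> \<otimes>\<^sub>a \<l> X) \<otimes>\<^sub>a \<iota> Y) \<cdot> (\<a> \<I> \<I> X \<otimes>\<^sub>a \<iota> Y))
      = ((\<iota> \<I> \<otimes>\<^sub>a (\<l> X \<otimes>\<^sub>a \<iota> Y)) \<cdot> \<a> \<I> (\<I> \<otimes>\<^sub>o X) Y) \<cdot> (\<a> \<I> \<I> X \<otimes>\<^sub>a \<iota> Y)"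
    using T by (intro Cmp_reassoc Assoc_natural) (auto simp: Hom_iff)
  also have "\<dots> = (\<iota> \<I> \<otimes>\<^sub>a (\<l> X \<otimes>\<^sub>a \<iota> Y)) \<cdot> ?p"
    using T by simp
  finally show "\<iota> \<I> \<otimes>\<^sub>a (\<l> (X \<otimes>\<^sub>o Y) \<cdot> \<a> \<I> X Y) = \<iota> \<I> \<otimes>\<^sub>a (\<l> X \<otimes>\<^sub>a \<iota> Y)"
    by (rule iso_cancel_right[rotated -1]) (use T in \<open>auto intro!: is_iso_Cmp is_iso_TensA\<close>)
qed (use X Y in \<open>auto simp: Hom_iff\<close>)

text \<open>The mirror argument: tensor with the unit on the right and use the pentagon for (X, Y,
  1, 1). The arrow cancelled at the end is now the associator on the left of both sides.\<close>

lemma RUnit_TensO: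
  assumes X: "X \<in> Obj M" and Y: "Y \<in> Obj M"
  shows "(\<iota> X \<otimes>\<^sub>a \<r> Y) \<cdot> \<a> X Y \<I> = \<r> (X \<otimes>\<^sub>o Y)"
proof (rule tensor_unit_right_faithful)
  note T = X Y
  have "\<a> X Y \<I> \<cdot> (((\<iota> X \<otimes>\<^sub>a \<r> Y) \<cdot> \<a> X Y \<I>) \<otimes>\<^sub>a \<iota> \<I>)
      = \<a> X Y \<I> \<cdot> (((\<iota> X \<otimes>\<^sub>a \<r> Y) \<otimes>\<^sub>a \<iota> \<I>) \<cdot> (\<a> X Y \<I> \<otimes>\<^sub>a \<iota> \<I>))"
    using T by simp
  also have "\<dots> = ((\<iota> X \<otimes>\<^sub>a (\<r> Y \<otimes>\<^sub>a \<iota> \<I>)) \<cdot> \<a> X (Y \<otimes>\<^sub>o \<I>) \<I>) \<cdot> (\<a> X Y \<I> \<otimes>\<^sub>a \<iota> \<I>)"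
    using T by (intro Cmp_reassoc Assoc_natural) (auto simp: Hom_iff)
  also have "\<iota> X \<otimes>\<^sub>a (\<r> Y \<otimes>\<^sub>a \<iota> \<I>) = (\<iota> X \<otimes>\<^sub>a (\<iota> Y \<otimes>\<^sub>a \<l> \<I>)) \<cdot> (\<iota> X \<otimes>\<^sub>a \<a> Y \<I> \<I>)"
    using T triangle[of Y \<I>] by simp
  also have "((\<iota> X \<otimes>\<^sub>a (\<iota> Y \<otimes>\<^sub>a \<l> \<I>)) \<cdot> (\<iota> X \<otimes>\<^sub>a \<a> Y \<I> \<I>)) \<cdot> \<a> X (Y \<otimes>\<^sub>o \<I>) \<I>
      = (\<iota> X \<otimes>\<^sub>a (\<iota> Y \<otimes>\<^sub>a \<l> \<I>)) \<cdot> ((\<iota> X \<otimes>\<^sub>a \<a> Y \<I> \<I>) \<cdot> \<a> X (Y \<otimes>\<^sub>o \<I>) \<I>)"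
    using T by (intro Cmp_assoc_simp) auto
  also have "\<dots> \<cdot> (\<a> X Y \<I> \<otimes>\<^sub>a \<iota> \<I>)
      = (\<iota> X \<otimes>\<^sub>a (\<iota> Y \<otimes>\<^sub>a \<l> \<I>)) \<cdot> ((\<iota> X \<otimes>\<^sub>a \<a> Y \<I> \<I>) \<cdot> \<a> X (Y \<otimes>\<^sub>o \<I>) \<I> \<cdot> (\<a> X Y \<I> \<otimes>\<^sub>a \<iota> \<I>))"
    using T by simp
  also have "\<dots> = (\<iota> X \<otimes>\<^sub>a (\<iota> Y \<otimes>\<^sub>a \<l> \<I>)) \<cdot> (\<a> X Y (\<I> \<otimes>\<^sub>o \<I>) \<cdot> \<a> (X \<otimes>\<^sub>o Y) \<I> \<I>)"
    using pentagon[of X Y \<I> \<I>] T by simp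
  also have "\<dots> = (\<a> X Y \<I> \<cdot> ((\<iota> X \<otimes>\<^sub>a \<iota> Y) \<otimes>\<^sub>a \<l> \<I>)) \<cdot> \<a> (X \<otimes>\<^sub>o Y) \<I> \<I>"
    using T by (intro Cmp_reassoc Assoc_natural[symmetric]) (auto simp: Hom_iff)
  also have "\<dots> = \<a> X Y \<I> \<cdot> (\<r> (X \<otimes>\<^sub>o Y) \<otimes>\<^sub>a \<iota> \<I>)"
    using T triangle[of "X \<otimes>\<^sub>o Y" \<I>] by simp
  finally show "((\<iota> X \<otimes>\<^sub>a \<r> Y) \<cdot> \<a> X Y \<I>) \<otimes>\<^sub>a \<iota> \<I> = \<r> (X \<otimes>\<^sub>o Y) \<otimes>\<^sub>a \<iota> \<I>"
    by (rule iso_cancel_left[rotated -1]) (use T in auto)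
qed (use X Y in \<open>auto simp: Hom_iff\<close>)

text \<open>Naturality of \<open>\<l>\<close> at \<open>\<l> \<I>\<close> itself, after cancelling
  \<open>\<l> \<I>\<close>, identifies \<open>\<l> (\<I> \<otimes>\<^sub>o \<I>)\<close> with
  \<open>\<iota> \<I> \<otimes>\<^sub>a \<l> \<I>\<close>. Then \<open>LUnit_TensO\<close> and the
  triangle have the same left-hand side.\<close>

lemma RUnit_Unit: "\<r> \<I> = \<l> \<I>"
proof (rule tensor_unit_right_faithful)
  have "\<l> \<I> \<cdot> \<l> (\<I> \<otimes>\<^sub>o \<I>) = \<l> \<I> \<cdot> (\<iota> \<I> \<otimes>\<^sub>a \<l> \<I>)"
    using LUnit_natural[of "\<l> \<I>" "\<I> \<otimes>\<^sub>o \<I>" \<I>] by (simp add: Hom_iff)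
  then have "\<l> (\<I> \<otimes>\<^sub>o \<I>) = \<iota> \<I> \<otimes>\<^sub>a \<l> \<I>"
    by (rule iso_cancel_left[rotated -1]) auto
  then show "\<r> \<I> \<otimes>\<^sub>a \<iota> \<I> = \<l> \<I> \<otimes>\<^sub>a \<iota> \<I>"
    using LUnit_TensO[of \<I> \<I>] triangle[of \<I> \<I>] by simp
qed (auto simp: Hom_iff)

end

section \<open>Bialgebras as braided bialgebras\<close>

context braided_monoidal_category
begin

lemma Braid_simps [simp]:
  assumes "X \<in> Obj M" "Y \<in> Obj M"
  shows "\<c> X Y \<in> Arr M" "Dom M (\<c> X Y) = X \<otimes>\<^sub>o Y" "Cod M (\<c> X Y) = Y \<otimes>\<^sub>o X" "is_iso M (\<c> X Y)"
  using assms Braid_Hom Braid_iso by (auto simp: Hom_iff)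

text \<open>The first hexagon solved for the braiding, with the bracketing that the axioms of
  braided algebras and coalgebras use, so that naturality squares turn into those axioms by
  substitution.\<close>

lemma Braid_TensO_right:
  assumes "X \<in> Obj M" "Y \<in> Obj M" "Z \<in> Obj M"
  shows "\<c> X (Y \<otimes>\<^sub>o Z)
    = Inv M (\<a> Y Z X) \<cdot> (\<iota> Y \<otimes>\<^sub>a \<c> X Z) \<cdot> \<a> Y X Z \<cdot> (\<c> X Y \<otimes>\<^sub>a \<iota> Z) \<cdot> Inv M (\<a> X Y Z)"
proof -
  have "\<c> X (Y \<otimes>\<^sub>o Z)
      = Inv M (\<a> Y Z X) \<cdot> (\<a> Y Z X \<cdot> \<c> X (Y \<otimes>\<^sub>o Z) \<cdot> \<a> X Y Z) \<cdot> Inv M (\<a> X Y Z)"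
    using assms by simp
  also have "\<dots> = Inv M (\<a> Y Z X) \<cdot> (\<iota> Y \<otimes>\<^sub>a \<c> X Z) \<cdot> \<a> Y X Z \<cdot> (\<c> X Y \<otimes>\<^sub>a \<iota> Z) \<cdot> Inv M (\<a> X Y Z)"
    unfolding hexagon1[OF assms] using assms by simp
  finally show ?thesis .
qed

lemma Braid_TensO_left:
  assumes "X \<in> Obj M" "Y \<in> Obj M" "Z \<in> Obj M"
  shows "\<c> (X \<otimes>\<^sub>o Y) Z
    = \<a> Z X Y \<cdot> (\<c> X Z \<otimes>\<^sub>a \<iota> Y) \<cdot> Inv M (\<a> X Z Y) \<cdot> (\<iota> X \<otimes>\<^sub>a \<c> Y Z) \<cdot> \<a> X Y Z"
proof -
  have "\<c> (X \<otimes>\<^sub>o Y) Z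
      = \<a> Z X Y \<cdot> (Inv M (\<a> Z X Y) \<cdot> \<c> (X \<otimes>\<^sub>o Y) Z \<cdot> Inv M (\<a> X Y Z)) \<cdot> \<a> X Y Z"
    using assms by simp
  also have "\<dots> = \<a> Z X Y \<cdot> (\<c> X Z \<otimes>\<^sub>a \<iota> Y) \<cdot> Inv M (\<a> X Z Y) \<cdot> (\<iota> X \<otimes>\<^sub>a \<c> Y Z) \<cdot> \<a> X Y Z"
    unfolding hexagon2[OF assms] using assms by simp
  finally show ?thesis .
qed

(* With phi = l c_{A,1}, the hexagon for (A, 1, 1) reads phi (phi (x) 1) = phi (r (x) 1), and phi is
   invertible. *)
lemma LUnit_Braid:
  assumes A: "A \<in> Obj M"
  shows "\<l> A \<cdot> \<c> A \<I> = \<r> A"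
proof (rule tensor_unit_right_faithful)
  let ?\<phi> = "\<l> A \<cdot> \<c> A \<I>"
  have "?\<phi> \<cdot> (?\<phi> \<otimes>\<^sub>a \<iota> \<I>) = ?\<phi> \<cdot> ((\<l> A \<otimes>\<^sub>a \<iota> \<I>) \<cdot> (\<c> A \<I> \<otimes>\<^sub>a \<iota> \<I>))"
    using A by simp
  also have "\<dots> = (?\<phi> \<cdot> \<l> (A \<otimes>\<^sub>o \<I>)) \<cdot> (\<a> \<I> A \<I> \<cdot> (\<c> A \<I> \<otimes>\<^sub>a \<iota> \<I>))"
    using A unfolding LUnit_TensO[OF A UnitO_Obj, symmetric] by simp
  \<comment> \<open>Naturality of \<open>\<l>\<close> at \<open>?\<phi>\<close> itself. It puts a
    second braiding under a tensor product with the unit, where the hexagon needs it.\<close>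
  also have "?\<phi> \<cdot> \<l> (A \<otimes>\<^sub>o \<I>) = \<l> A \<cdot> (\<iota> \<I> \<otimes>\<^sub>a ?\<phi>)"
    using A by (intro LUnit_natural[symmetric]) (auto simp: Hom_iff)
  also have "(\<l> A \<cdot> (\<iota> \<I> \<otimes>\<^sub>a ?\<phi>)) \<cdot> (\<a> \<I> A \<I> \<cdot> (\<c> A \<I> \<otimes>\<^sub>a \<iota> \<I>))
      = \<l> A \<cdot> (\<iota> \<I> \<otimes>\<^sub>a \<l> A) \<cdot> ((\<iota> \<I> \<otimes>\<^sub>a \<c> A \<I>) \<cdot> \<a> \<I> A \<I> \<cdot> (\<c> A \<I> \<otimes>\<^sub>a \<iota> \<I>))"
    using A by simp
  also have "\<dots> = \<l> A \<cdot> (\<iota> \<I> \<otimes>\<^sub>a \<l> A) \<cdot> (\<a> \<I> \<I> A \<cdot> \<c> A (\<I> \<otimes>\<^sub>o \<I>) \<cdot> \<a> A \<I> \<I>)"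
    using hexagon1[OF A UnitO_Obj UnitO_Obj] by simp
  also have "(\<iota> \<I> \<otimes>\<^sub>a \<l> A) \<cdot> (\<a> \<I> \<I> A \<cdot> \<c> A (\<I> \<otimes>\<^sub>o \<I>) \<cdot> \<a> A \<I> \<I>)
      = (\<r> \<I> \<otimes>\<^sub>a \<iota> A) \<cdot> (\<c> A (\<I> \<otimes>\<^sub>o \<I>) \<cdot> \<a> A \<I> \<I>)"
    using A by (intro Cmp_reassoc triangle) auto
  also have "\<dots> = (\<c> A \<I> \<cdot> (\<iota> A \<otimes>\<^sub>a \<r> \<I>)) \<cdot> \<a> A \<I> \<I>"
    using A by (intro Cmp_reassoc Braid_natural[symmetric]) (auto simp: Hom_iff)
  also have "\<dots> = \<c> A \<I> \<cdot> (\<r> A \<otimes>\<^sub>a \<iota> \<I>)"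
    using A triangle[of A \<I>] by (simp add: RUnit_Unit)
  also have "\<l> A \<cdot> (\<c> A \<I> \<cdot> (\<r> A \<otimes>\<^sub>a \<iota> \<I>)) = ?\<phi> \<cdot> (\<r> A \<otimes>\<^sub>a \<iota> \<I>)"
    using A by simp
  finally show "?\<phi> \<otimes>\<^sub>a \<iota> \<I> = \<r> A \<otimes>\<^sub>a \<iota> \<I>"
    by (rule iso_cancel_left[rotated -1]) (use A in \<open>auto intro!: is_iso_Cmp\<close>)
qed (use A in \<open>auto simp: Hom_iff\<close>)

text \<open>The mirror image of the previous argument, with psi = r c_{1,A}: the hexagon for (1, 1,
  A) yields psi (1 (x) psi) = psi (1 (x) l), and psi is invertible.\<close>

lemma RUnit_Braid:
  assumes A: "A \<in> Obj M"
  shows "\<r> A \<cdot> \<c> \<I> A = \<l> A"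
proof (rule tensor_unit_left_faithful)
  let ?\<psi> = "\<r> A \<cdot> \<c> \<I> A"
  have "(?\<psi> \<cdot> (\<iota> \<I> \<otimes>\<^sub>a ?\<psi>)) \<cdot> \<a> \<I> \<I> A
      = ?\<psi> \<cdot> (\<iota> \<I> \<otimes>\<^sub>a \<r> A) \<cdot> ((\<iota> \<I> \<otimes>\<^sub>a \<c> \<I> A) \<cdot> \<a> \<I> \<I> A)"
    using A by simp
  \<comment> \<open>An associator and its inverse are inserted: the left group is the one of
    \<open>RUnit_TensO\<close>, the right group is the tail of the hexagon expansion of
    \<open>\<c> (\<I> \<otimes>\<^sub>o \<I>) A\<close>.\<close>
  also have "\<dots> = ?\<psi> \<cdot> ((\<iota> \<I> \<otimes>\<^sub>a \<r> A) \<cdot> \<a> \<I> A \<I>)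
      \<cdot> (Inv M (\<a> \<I> A \<I>) \<cdot> (\<iota> \<I> \<otimes>\<^sub>a \<c> \<I> A) \<cdot> \<a> \<I> \<I> A)"
    using A by (simp del: TensA_interchange_reassoc)
  also have "\<dots> = (?\<psi> \<cdot> \<r> (\<I> \<otimes>\<^sub>o A)) \<cdot> (Inv M (\<a> \<I> A \<I>) \<cdot> (\<iota> \<I> \<otimes>\<^sub>a \<c> \<I> A) \<cdot> \<a> \<I> \<I> A)"
    unfolding RUnit_TensO[OF UnitO_Obj A] using A by simp
  also have "?\<psi> \<cdot> \<r> (\<I> \<otimes>\<^sub>o A) = \<r> A \<cdot> (?\<psi> \<otimes>\<^sub>a \<iota> \<I>)"
    using A by (intro RUnit_natural[symmetric]) (auto simp: Hom_iff)
  also have "(\<r> A \<cdot> (?\<psi> \<otimes>\<^sub>a \<iota> \<I>)) \<cdot> (Inv M (\<a> \<I> A \<I>) \<cdot> (\<iota> \<I> \<otimes>\<^sub>a \<c> \<I> A) \<cdot> \<a> \<I> \<I> A)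
      = \<r> A \<cdot> ((\<iota> A \<otimes>\<^sub>a \<l> \<I>) \<cdot> \<a> A \<I> \<I>)
        \<cdot> ((\<c> \<I> A \<otimes>\<^sub>a \<iota> \<I>) \<cdot> Inv M (\<a> \<I> A \<I>) \<cdot> (\<iota> \<I> \<otimes>\<^sub>a \<c> \<I> A) \<cdot> \<a> \<I> \<I> A)"
    unfolding triangle[OF A UnitO_Obj] using A by simp
  also have "\<dots> = \<r> A \<cdot> (\<iota> A \<otimes>\<^sub>a \<l> \<I>) \<cdot> \<c> (\<I> \<otimes>\<^sub>o \<I>) A"
    unfolding Braid_TensO_left[OF UnitO_Obj UnitO_Obj A] using A by simp
  also have "(\<iota> A \<otimes>\<^sub>a \<l> \<I>) \<cdot> \<c> (\<I> \<otimes>\<^sub>o \<I>) A = \<c> \<I> A \<cdot> (\<l> \<I> \<otimes>\<^sub>a \<iota> A)"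
    using A by (intro Braid_natural[symmetric]) (auto simp: Hom_iff)
  \<comment> \<open>The triangle has \<open>\<r> \<I>\<close> in this place; the two unit
    constraints agree at the unit object.\<close>
  also have "\<l> \<I> \<otimes>\<^sub>a \<iota> A = (\<iota> \<I> \<otimes>\<^sub>a \<l> A) \<cdot> \<a> \<I> \<I> A"
    using A triangle[of \<I> A] by (simp add: RUnit_Unit)
  also have "\<r> A \<cdot> \<c> \<I> A \<cdot> (\<iota> \<I> \<otimes>\<^sub>a \<l> A) \<cdot> \<a> \<I> \<I> A = (?\<psi> \<cdot> (\<iota> \<I> \<otimes>\<^sub>a \<l> A)) \<cdot> \<a> \<I> \<I> A"
    using A by simp
  finally have "?\<psi> \<cdot> (\<iota> \<I> \<otimes>\<^sub>a ?\<psi>) = ?\<psi> \<cdot> (\<iota> \<I> \<otimes>\<^sub>a \<l> A)"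
    by (rule iso_cancel_right[rotated -1]) (use A in auto)
  then show "\<iota> \<I> \<otimes>\<^sub>a ?\<psi> = \<iota> \<I> \<otimes>\<^sub>a \<l> A"
    by (rule iso_cancel_left[rotated -1]) (use A in \<open>auto intro!: is_iso_Cmp\<close>)
qed (use A in \<open>auto simp: Hom_iff\<close>)

lemma Braid_Inv_LUnit:
  assumes A: "A \<in> Obj M"
  shows "\<c> \<I> A \<cdot> Inv M (\<l> A) = Inv M (\<r> A)"
proof -
  have "\<c> \<I> A \<cdot> Inv M (\<l> A) = Inv M (\<r> A) \<cdot> (\<r> A \<cdot> \<c> \<I> A) \<cdot> Inv M (\<l> A)"
    using A by simp
  then show ?thesis
    unfolding RUnit_Braid[OF A] using A by simp
qed

lemma Braid_Inv_RUnit: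
  assumes A: "A \<in> Obj M"
  shows "\<c> A \<I> \<cdot> Inv M (\<r> A) = Inv M (\<l> A)"
proof -
  have "\<c> A \<I> \<cdot> Inv M (\<r> A) = Inv M (\<l> A) \<cdot> (\<l> A \<cdot> \<c> A \<I>) \<cdot> Inv M (\<r> A)"
    using A by simp
  then show ?thesis
    unfolding LUnit_Braid[OF A] using A by simp
qed

text \<open>The braid relation is naturality of c_{V,-} at the arrow c_{V,V}: on each side two of
  the three factors form the hexagon expansion of the braiding of V with V (x) V.\<close>

lemma braided_object_Braid:
  assumes V: "V \<in> Obj M"
  shows "is_braided_object M V (\<c> V V)"
proof -
  let ?cV = "\<c> V V \<otimes>\<^sub>a \<iota> V" and ?Vc = "Inv M (\<a> V V V) \<cdot> (\<iota> V \<otimes>\<^sub>a \<c> V V) \<cdot> \<a> V V V"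
  have "?cV \<cdot> ?Vc \<cdot> ?cV = ?cV \<cdot> \<c> V (V \<otimes>\<^sub>o V) \<cdot> \<a> V V V"
    unfolding Braid_TensO_right[OF V V V] using V by simp
  also have "\<dots> = (\<c> V (V \<otimes>\<^sub>o V) \<cdot> (\<iota> V \<otimes>\<^sub>a \<c> V V)) \<cdot> \<a> V V V"
    using V by (intro Cmp_reassoc Braid_natural[symmetric]) (auto simp: Hom_iff)
  also have "\<dots> = ?Vc \<cdot> ?cV \<cdot> ?Vc"
    unfolding Braid_TensO_right[OF V V V] using V by simp
  finally show ?thesis
    using V by (simp add: is_braided_object_def Hom_iff del: Cmp_assoc_simp)
qed

lemma braided_object_morphism_Braid:
  assumes f: "f \<in> Hom M V W"
  shows "braided_object_morphism M V (\<c> V V) W (\<c> W W) f"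
  using f Braid_natural[OF f f] by (simp add: braided_object_morphism_def)

text \<open>Each axiom is naturality of the braiding at \<open>m\<close> or at \<open>u\<close>
  against the identity of \<open>A\<close>. The braiding on the other side of the square is then
  expanded by a hexagon, respectively absorbed into a unit constraint.\<close>

lemma braided_algebra_Braid:
  assumes A: "is_algebra M A m u"
  shows "is_braided_algebra M A m u (\<c> A A)"
proof -
  have T: "A \<in> Obj M" and m: "m \<in> Hom M (A \<otimes>\<^sub>o A) A" and u: "u \<in> Hom M \<I> A"
    using A by (auto simp: is_algebra_def)
  have I: "\<iota> A \<in> Hom M A A"
    using T by (rule Idt_Hom)
  have "\<c> A A \<cdot> (u \<otimes>\<^sub>a \<iota> A) \<cdot> Inv M (\<l> A) = ((\<iota> A \<otimes>\<^sub>a u) \<cdot> \<c> \<I> A) \<cdot> Inv M (\<l> A)"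
    using T u by (intro Cmp_reassoc Braid_natural[OF u I]) (auto simp: Hom_iff)
  also have "\<dots> = (\<iota> A \<otimes>\<^sub>a u) \<cdot> Inv M (\<r> A)"
    unfolding Braid_Inv_LUnit[OF T, symmetric] using T u by (simp add: Hom_iff)
  finally have unit_left: "\<c> A A \<cdot> (u \<otimes>\<^sub>a \<iota> A) \<cdot> Inv M (\<l> A) = (\<iota> A \<otimes>\<^sub>a u) \<cdot> Inv M (\<r> A)" .
  have "\<c> A A \<cdot> (\<iota> A \<otimes>\<^sub>a u) \<cdot> Inv M (\<r> A) = ((u \<otimes>\<^sub>a \<iota> A) \<cdot> \<c> A \<I>) \<cdot> Inv M (\<r> A)"
    using T u by (intro Cmp_reassoc Braid_natural[OF I u]) (auto simp: Hom_iff)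
  also have "\<dots> = (u \<otimes>\<^sub>a \<iota> A) \<cdot> Inv M (\<l> A)"
    unfolding Braid_Inv_RUnit[OF T, symmetric] using T u by (simp add: Hom_iff)
  finally have unit_right: "\<c> A A \<cdot> (\<iota> A \<otimes>\<^sub>a u) \<cdot> Inv M (\<r> A) = (u \<otimes>\<^sub>a \<iota> A) \<cdot> Inv M (\<l> A)" .
  show ?thesis
    unfolding is_braided_algebra_def
    using A braided_object_Braid[OF T] Braid_natural[OF m I] Braid_natural[OF I m] unit_left unit_right
    by (simp only: Braid_TensO_left[OF T T T] Braid_TensO_right[OF T T T])
qed

text \<open>The same squares for \<open>\<Delta>\<close> and \<open>\<epsilon>\<close>, read in the
  other direction, so that the structure map is now applied before the expanded braiding.\<close>

lemma braided_coalgebra_Braid: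
  assumes C: "is_coalgebra M C \<Delta> \<epsilon>"
  shows "is_braided_coalgebra M C \<Delta> \<epsilon> (\<c> C C)"
proof -
  have T: "C \<in> Obj M" and \<Delta>: "\<Delta> \<in> Hom M C (C \<otimes>\<^sub>o C)" and \<epsilon>: "\<epsilon> \<in> Hom M C \<I>"
    using C by (auto simp: is_coalgebra_def)
  have I: "\<iota> C \<in> Hom M C C"
    using T by (rule Idt_Hom)
  have comult_left: "(\<Delta> \<otimes>\<^sub>a \<iota> C) \<cdot> \<c> C C
      = Inv M (\<a> C C C) \<cdot> (\<iota> C \<otimes>\<^sub>a \<c> C C) \<cdot> \<a> C C C \<cdot> (\<c> C C \<otimes>\<^sub>a \<iota> C) \<cdot> Inv M (\<a> C C C) \<cdot> (\<iota> C \<otimes>\<^sub>a \<Delta>)"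
    unfolding Braid_natural[OF I \<Delta>, symmetric] Braid_TensO_right[OF T T T]
    using T \<Delta> by (simp add: Hom_iff)
  have comult_right: "(\<iota> C \<otimes>\<^sub>a \<Delta>) \<cdot> \<c> C C
      = \<a> C C C \<cdot> (\<c> C C \<otimes>\<^sub>a \<iota> C) \<cdot> Inv M (\<a> C C C) \<cdot> (\<iota> C \<otimes>\<^sub>a \<c> C C) \<cdot> \<a> C C C \<cdot> (\<Delta> \<otimes>\<^sub>a \<iota> C)"
    unfolding Braid_natural[OF \<Delta> I, symmetric] Braid_TensO_left[OF T T T]
    using T \<Delta> by (simp add: Hom_iff)
  have counit_left: "\<l> C \<cdot> (\<epsilon> \<otimes>\<^sub>a \<iota> C) \<cdot> \<c> C C = \<r> C \<cdot> (\<iota> C \<otimes>\<^sub>a \<epsilon>)"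
    unfolding Braid_natural[OF I \<epsilon>, symmetric] LUnit_Braid[OF T, symmetric]
    using T \<epsilon> by (simp add: Hom_iff)
  have counit_right: "\<r> C \<cdot> (\<iota> C \<otimes>\<^sub>a \<epsilon>) \<cdot> \<c> C C = \<l> C \<cdot> (\<epsilon> \<otimes>\<^sub>a \<iota> C)"
    unfolding Braid_natural[OF \<epsilon> I, symmetric] RUnit_Braid[OF T, symmetric]
    using T \<epsilon> by (simp add: Hom_iff)
  show ?thesis
    unfolding is_braided_coalgebra_def
    using C braided_object_Braid[OF T] comult_left comult_right counit_left counit_right by blast
qed

lemma mid_Hom:
  assumes "V \<in> Obj M" "c \<in> Hom M (V \<otimes>\<^sub>o V) (V \<otimes>\<^sub>o V)"
  shows "mid M V c \<in> Hom M ((V \<otimes>\<^sub>o V) \<otimes>\<^sub>o (V \<otimes>\<^sub>o V)) ((V \<otimes>\<^sub>o V) \<otimes>\<^sub>o (V \<otimes>\<^sub>o V))"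
  using assms by (simp add: mid_def Hom_iff)

lemma braided_bialgebra_Braid:
  assumes B: "is_bialgebra M B m u \<Delta> \<epsilon>"
  shows "is_braided_bialgebra M B m u \<Delta> \<epsilon> (\<c> B B)"
proof -
  have alg: "is_algebra M B m u" and coalg: "is_coalgebra M B \<Delta> \<epsilon>"
    and \<Delta>m: "\<Delta> \<cdot> m = ((m \<otimes>\<^sub>a m) \<cdot> mid M B (\<c> B B)) \<cdot> (\<Delta> \<otimes>\<^sub>a \<Delta>)"
    and rest: "\<Delta> \<cdot> u = (u \<otimes>\<^sub>a u) \<cdot> Inv M (\<l> \<I>)" "\<epsilon> \<cdot> m = \<l> \<I> \<cdot> (\<epsilon> \<otimes>\<^sub>a \<epsilon>)" "\<epsilon> \<cdot> u = \<iota> \<I>"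
    using B by (auto simp: is_bialgebra_def algebra_morphism_def)
  have T: "B \<in> Obj M" and m: "m \<in> Hom M (B \<otimes>\<^sub>o B) B" and \<Delta>: "\<Delta> \<in> Hom M B (B \<otimes>\<^sub>o B)"
    using alg coalg by (auto simp: is_algebra_def is_coalgebra_def)
  \<comment> \<open>Only the grouping changes: as an algebra morphism, \<open>\<Delta>\<close> meets
    the product of B (x) B, in which \<open>mid\<close> is bracketed together with
    \<open>m \<otimes>\<^sub>a m\<close>.\<close>
  have "\<Delta> \<cdot> m = (m \<otimes>\<^sub>a m) \<cdot> mid M B (\<c> B B) \<cdot> (\<Delta> \<otimes>\<^sub>a \<Delta>)"
    unfolding \<Delta>m using T m \<Delta> mid_Hom[OF T Braid_Hom[OF T T]] by (simp add: Hom_iff)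
  then show ?thesis
    unfolding is_braided_bialgebra_def
    using braided_algebra_Braid[OF alg] braided_coalgebra_Braid[OF coalg] rest by blast
qed

end

section \<open>Functors and categories of structured objects\<close>

lemma functor_Hom:
  assumes "is_functor C D F" "f \<in> Hom C X Y"
  shows "on_arr F f \<in> Hom D (on_obj F X) (on_obj F Y)"
  using assms by (auto simp: is_functor_def Hom_iff)

lemma functor_Cmp:
  assumes "is_functor C D F" "f \<in> Hom C X Y" "g \<in> Hom C Y Z"
  shows "on_arr F (g \<cdot>\<^bsub>C\<^esub> f) = on_arr F g \<cdot>\<^bsub>D\<^esub> on_arr F f"
  using assms by (auto simp: is_functor_def Hom_iff)

lemma is_functor_fcomp:
  assumes "is_functor C D F" "is_functor D E G"
  shows "is_functor C E (G \<circ>\<^sub>F F)"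
  using assms unfolding is_functor_def fcomp_def by (simp add: Hom_iff)

text \<open>Functoriality passes from \<open>G\<close> to \<open>F\<close>, because the functor laws
  evaluate only at objects and arrows of the source, and identities and composites stay
  there.\<close>

lemma (in category) functor_eqI:
  assumes G: "is_functor C D G"
    and obj: "\<And>X. X \<in> Obj C \<Longrightarrow> on_obj F X = on_obj G X"
    and arr: "\<And>f. f \<in> Arr C \<Longrightarrow> on_arr F f = on_arr G f"
  shows "functor_eq C D F G"
proof -
  have "is_functor C D F"
    using G by (simp add: is_functor_def obj arr)
  then show ?thesis
    using assms by (simp add: functor_eq_def)
qed

lemma (in category) is_ntrans_whisker_left:
  assumes G: "is_functor D E G" and \<tau>: "is_ntrans C D \<tau>"
  shows "is_ntrans C E (G \<star>\<^sub>L \<tau>)"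
proof -
  have F: "is_functor C D (nt_src \<tau>)" "is_functor C D (nt_tgt \<tau>)"
    and comp: "\<And>X. X \<in> Obj C \<Longrightarrow> nt_comp \<tau> X \<in> Hom D (on_obj (nt_src \<tau>) X) (on_obj (nt_tgt \<tau>) X)"
    and nat: "\<And>f. f \<in> Arr C \<Longrightarrow> nt_comp \<tau> (Cod C f) \<cdot>\<^bsub>D\<^esub> on_arr (nt_src \<tau>) f
                   = on_arr (nt_tgt \<tau>) f \<cdot>\<^bsub>D\<^esub> nt_comp \<tau> (Dom C f)"
    using \<tau> by (auto simp: is_ntrans_def)
  show ?thesis
    unfolding is_ntrans_def whisker_left_def ntrans.sel
  proof (intro conjI ballI)
    show "is_functor C E (G \<circ>\<^sub>F nt_src \<tau>)" "is_functor C E (G \<circ>\<^sub>F nt_tgt \<tau>)"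
      by (rule is_functor_fcomp[OF _ G], rule F)+
  next
    fix X assume "X \<in> Obj C"
    then show "on_arr G (nt_comp \<tau> X) \<in> Hom E (on_obj (G \<circ>\<^sub>F nt_src \<tau>) X) (on_obj (G \<circ>\<^sub>F nt_tgt \<tau>) X)"
      using functor_Hom[OF G comp] by (simp add: fcomp_def)
  next
    fix f assume f: "f \<in> Arr C"
    then have f': "f \<in> Hom C (Dom C f) (Cod C f)" and obj: "Dom C f \<in> Obj C" "Cod C f \<in> Obj C"
      using Dom_Obj[OF f] Cod_Obj[OF f] by (auto simp: Hom_iff)
    show "on_arr G (nt_comp \<tau> (Cod C f)) \<cdot>\<^bsub>E\<^esub> on_arr (G \<circ>\<^sub>F nt_src \<tau>) f
        = on_arr (G \<circ>\<^sub>F nt_tgt \<tau>) f \<cdot>\<^bsub>E\<^esub> on_arr G (nt_comp \<tau> (Dom C f))"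
      using functor_Cmp[OF G functor_Hom[OF F(1) f'] comp[OF obj(2)]]
        functor_Cmp[OF G comp[OF obj(1)] functor_Hom[OF F(2) f']] nat[OF f]
      by (simp add: fcomp_def)
  qed
qed

text \<open>The same transport for naturality, from \<open>\<tau>\<close> to
  \<open>\<sigma>\<close>.\<close>

lemma (in category) ntrans_eqI:
  assumes \<tau>: "is_ntrans C D \<tau>"
    and src: "functor_eq C D (nt_src \<sigma>) (nt_src \<tau>)"
    and tgt: "functor_eq C D (nt_tgt \<sigma>) (nt_tgt \<tau>)"
    and comp: "\<And>X. X \<in> Obj C \<Longrightarrow> nt_comp \<sigma> X = nt_comp \<tau> X"
  shows "ntrans_eq C D \<sigma> \<tau>"
proof -
  have "is_ntrans C D \<sigma>"
    using \<tau> src tgt by (simp add: is_ntrans_def functor_eq_def comp)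
  then show ?thesis
    using assms by (simp add: ntrans_eq_def)
qed

section \<open>Categories of structured objects\<close>

lemma structured_cat_simps [simp]:
  "Obj (structured_cat M S U R) = S"
  "f \<in> Arr (structured_cat M S U R)
    \<longleftrightarrow> sa_src f \<in> S \<and> sa_tgt f \<in> S \<and> R (sa_src f) (sa_tgt f) (sa_arr f)"
  "Dom (structured_cat M S U R) = sa_src"
  "Cod (structured_cat M S U R) = sa_tgt"
  "Idt (structured_cat M S U R) X = SArr X (Idt M (U X)) X"
  "Cmp (structured_cat M S U R) g f = SArr (sa_src f) (Cmp M (sa_arr g) (sa_arr f)) (sa_tgt g)"
  by (cases f; auto simp: structured_cat_def)+

text \<open>A structured arrow is determined by its two ends and its underlying arrow, so the
  category laws are inherited; what remains is closure under identities and composition.\<close>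

lemma (in category) category_structured_cat:
  assumes obj: "\<And>X. X \<in> S \<Longrightarrow> U X \<in> Obj C"
    and hom: "\<And>X Y f. R X Y f \<Longrightarrow> f \<in> Hom C (U X) (U Y)"
    and idt: "\<And>X. X \<in> S \<Longrightarrow> R X X (\<iota> (U X))"
    and cmp: "\<And>X Y Z f g. \<lbrakk>X \<in> S; Y \<in> S; Z \<in> S; R X Y f; R Y Z g\<rbrakk> \<Longrightarrow> R X Z (g \<cdot> f)"
  shows "category (structured_cat C S U R)"
proof (unfold_locales, goal_cases)
  case (4 f X Y g Z)
  then show ?case
    by (auto simp: Hom_iff intro: cmp)
next
  case (5 f X Y)
  then show ?case
    using hom[of X Y "sa_arr f"] by (cases f) (auto simp: Hom_iff)
next
  case (6 f X Y)
  then show ?case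
    using hom[of X Y "sa_arr f"] by (cases f) (auto simp: Hom_iff)
next
  case (7 f W X g Y h Z)
  then show ?case
    using hom[of W X "sa_arr f"] hom[of X Y "sa_arr g"] hom[of Y Z "sa_arr h"]
    by (auto simp: Hom_iff)
qed (auto simp: Hom_iff idt)

section \<open>Morphisms of algebras and coalgebras; tensor products of equalizers\<close>

context monoidal_category
begin

lemma algebra_morphism_Idt:
  assumes "is_algebra M A m u"
  shows "algebra_morphism M A m u A m u (\<iota> A)"
  using assms by (simp add: algebra_morphism_def is_algebra_def Hom_iff)

lemma algebra_morphism_Cmp:
  assumes "is_algebra M A m u" "is_algebra M A' m' u'" "is_algebra M A'' m'' u''"
    and f: "algebra_morphism M A m u A' m' u' f" and g: "algebra_morphism M A' m' u' A'' m'' u'' g"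
  shows "algebra_morphism M A m u A'' m'' u'' (g \<cdot> f)"
proof -
  have T: "A \<in> Obj M" "A' \<in> Obj M" "A'' \<in> Obj M" "m \<in> Hom M (A \<otimes>\<^sub>o A) A" "m' \<in> Hom M (A' \<otimes>\<^sub>o A') A'"
      "m'' \<in> Hom M (A'' \<otimes>\<^sub>o A'') A''" "u \<in> Hom M \<I> A" "f \<in> Hom M A A'" "g \<in> Hom M A' A''"
    and fm: "f \<cdot> m = m' \<cdot> (f \<otimes>\<^sub>a f)" and gm: "g \<cdot> m' = m'' \<cdot> (g \<otimes>\<^sub>a g)" and u: "f \<cdot> u = u'" "g \<cdot> u' = u''"
    using assms by (auto simp: algebra_morphism_def is_algebra_def)
  have "(g \<cdot> f) \<cdot> m = g \<cdot> (m' \<cdot> (f \<otimes>\<^sub>a f))"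
    unfolding fm[symmetric] using T by (simp add: Hom_iff)
  also have "\<dots> = (m'' \<cdot> (g \<otimes>\<^sub>a g)) \<cdot> (f \<otimes>\<^sub>a f)"
    using T gm by (intro Cmp_reassoc) (auto simp: Hom_iff)
  also have "\<dots> = m'' \<cdot> ((g \<cdot> f) \<otimes>\<^sub>a (g \<cdot> f))"
    using T by (simp add: Hom_iff)
  finally show ?thesis
    using T u by (auto simp: algebra_morphism_def Hom_iff)
qed

lemma coalgebra_morphism_Idt:
  assumes "is_coalgebra M C \<Delta> \<epsilon>"
  shows "coalgebra_morphism M C \<Delta> \<epsilon> C \<Delta> \<epsilon> (\<iota> C)"
  using assms by (simp add: coalgebra_morphism_def is_coalgebra_def Hom_iff)

lemma coalgebra_morphism_Cmp:
  assumes "is_coalgebra M C \<Delta> \<epsilon>" "is_coalgebra M C' \<Delta>' \<epsilon>'" "is_coalgebra M C'' \<Delta>'' \<epsilon>''"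
    and f: "coalgebra_morphism M C \<Delta> \<epsilon> C' \<Delta>' \<epsilon>' f" and g: "coalgebra_morphism M C' \<Delta>' \<epsilon>' C'' \<Delta>'' \<epsilon>'' g"
  shows "coalgebra_morphism M C \<Delta> \<epsilon> C'' \<Delta>'' \<epsilon>'' (g \<cdot> f)"
proof -
  have T: "C \<in> Obj M" "C' \<in> Obj M" "C'' \<in> Obj M" "\<Delta> \<in> Hom M C (C \<otimes>\<^sub>o C)" "\<Delta>' \<in> Hom M C' (C' \<otimes>\<^sub>o C')"
      "\<Delta>'' \<in> Hom M C'' (C'' \<otimes>\<^sub>o C'')" "\<epsilon>'' \<in> Hom M C'' \<I>" "f \<in> Hom M C C'" "g \<in> Hom M C' C''"
    and f\<Delta>: "\<Delta>' \<cdot> f = (f \<otimes>\<^sub>a f) \<cdot> \<Delta>" and g\<Delta>: "\<Delta>'' \<cdot> g = (g \<otimes>\<^sub>a g) \<cdot> \<Delta>'" and \<epsilon>: "\<epsilon>' \<cdot> f = \<epsilon>" "\<epsilon>'' \<cdot> g = \<epsilon>'"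
    using assms by (auto simp: coalgebra_morphism_def is_coalgebra_def)
  have "\<Delta>'' \<cdot> (g \<cdot> f) = ((g \<otimes>\<^sub>a g) \<cdot> \<Delta>') \<cdot> f"
    using T g\<Delta> by (intro Cmp_reassoc) (auto simp: Hom_iff)
  also have "\<dots> = (g \<otimes>\<^sub>a g) \<cdot> ((f \<otimes>\<^sub>a f) \<cdot> \<Delta>)"
    unfolding f\<Delta>[symmetric] using T by (simp add: Hom_iff)
  also have "\<dots> = ((g \<cdot> f) \<otimes>\<^sub>a (g \<cdot> f)) \<cdot> \<Delta>"
    using T by (simp add: Hom_iff)
  finally have "\<Delta>'' \<cdot> (g \<cdot> f) = ((g \<cdot> f) \<otimes>\<^sub>a (g \<cdot> f)) \<cdot> \<Delta>" .
  moreover have "\<epsilon>'' \<cdot> (g \<cdot> f) = \<epsilon>"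
    using Cmp_reassoc[OF \<epsilon>(2), of f] T \<epsilon>(1) by (simp add: Hom_iff)
  ultimately show ?thesis
    using T by (auto simp: coalgebra_morphism_def Hom_iff)
qed

text \<open>Needed, with its left-handed twin, to slide a bialgebra morphism past the two summands x
  (x) 1 and 1 (x) x in the equation for primitive elements.\<close>

lemma Inv_RUnit_natural:
  assumes f: "f \<in> Hom M X Y"
  shows "Inv M (\<r> Y) \<cdot> f = (f \<otimes>\<^sub>a \<iota> \<I>) \<cdot> Inv M (\<r> X)"
proof -
  have T: "X \<in> Obj M" "Y \<in> Obj M"
    using Hom_Obj[OF f] by auto
  have "Inv M (\<r> Y) \<cdot> f = Inv M (\<r> Y) \<cdot> (f \<cdot> \<r> X) \<cdot> Inv M (\<r> X)"
    using T f by (simp add: Hom_iff)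
  also have "\<dots> = (f \<otimes>\<^sub>a \<iota> \<I>) \<cdot> Inv M (\<r> X)"
    unfolding RUnit_natural[OF f, symmetric] using T f by (simp add: Hom_iff)
  finally show ?thesis .
qed

lemma Inv_LUnit_natural:
  assumes f: "f \<in> Hom M X Y"
  shows "Inv M (\<l> Y) \<cdot> f = (\<iota> \<I> \<otimes>\<^sub>a f) \<cdot> Inv M (\<l> X)"
proof -
  have T: "X \<in> Obj M" "Y \<in> Obj M"
    using Hom_Obj[OF f] by auto
  have "Inv M (\<l> Y) \<cdot> f = Inv M (\<l> Y) \<cdot> (f \<cdot> \<l> X) \<cdot> Inv M (\<l> X)"
    using T f by (simp add: Hom_iff)
  also have "\<dots> = (\<iota> \<I> \<otimes>\<^sub>a f) \<cdot> Inv M (\<l> X)"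
    unfolding LUnit_natural[OF f, symmetric] using T f by (simp add: Hom_iff)
  finally show ?thesis .
qed

text \<open>Factor e (x) e' as e (x) A' after P (x) e', where P is the domain of e and A' the
  codomain of e'. Each factor is the image of an equalizer under a tensor functor, hence an
  equalizer, so the two can be cancelled one after the other.\<close>

lemma tensor_equalizers_mono:
  assumes e: "is_equalizer M e f g" and e': "is_equalizer M e' f' g'"
    and left: "preserves_equalizers M M (tensor_left M (Dom M e))"
    and right: "preserves_equalizers M M (tensor_right M (Cod M e'))"
    and h: "h \<in> Hom M X (Dom M e \<otimes>\<^sub>o Dom M e')" and k: "k \<in> Hom M X (Dom M e \<otimes>\<^sub>o Dom M e')"
    and eq: "(e \<otimes>\<^sub>a e') \<cdot> h = (e \<otimes>\<^sub>a e') \<cdot> k"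
  shows "h = k"
proof -
  let ?P = "Dom M e" and ?A = "Cod M e'"
  have E: "e \<in> Arr M" "e' \<in> Arr M"
    using equalizer_Hom[OF e] equalizer_Hom[OF e'] by auto
  have eqL: "is_equalizer M (\<iota> ?P \<otimes>\<^sub>a e') (\<iota> ?P \<otimes>\<^sub>a f') (\<iota> ?P \<otimes>\<^sub>a g')"
    using left e' by (auto simp: preserves_equalizers_def tensor_left_def)
  have eqR: "is_equalizer M (e \<otimes>\<^sub>a \<iota> ?A) (f \<otimes>\<^sub>a \<iota> ?A) (g \<otimes>\<^sub>a \<iota> ?A)"
    using right e by (auto simp: preserves_equalizers_def tensor_right_def)
  have "(e \<otimes>\<^sub>a \<iota> ?A) \<cdot> ((\<iota> ?P \<otimes>\<^sub>a e') \<cdot> h) = (e \<otimes>\<^sub>a \<iota> ?A) \<cdot> ((\<iota> ?P \<otimes>\<^sub>a e') \<cdot> k)"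
    using E h k eq by (simp add: Hom_iff)
  then have "(\<iota> ?P \<otimes>\<^sub>a e') \<cdot> h = (\<iota> ?P \<otimes>\<^sub>a e') \<cdot> k"
    by (rule equalizer_mono[OF eqR, where X = X, rotated 2]) (use E h k in \<open>auto simp: Hom_iff\<close>)
  then show ?thesis
    by (rule equalizer_mono[OF eqL, where X = X, rotated 2]) (use E h k in \<open>auto simp: Hom_iff\<close>)
qed

end

section \<open>The category of bialgebras and the functor J\<close>

context braided_monoidal_category
begin

lemma category_Bialg_cat: "category (Bialg_cat M)"
  unfolding Bialg_cat_def
proof (rule category_structured_cat, goal_cases)
  case (1 X)
  then show ?case
    by (simp add: is_bialgebra_def is_algebra_def)
next
  case (2 X Y f)
  then show ?case
    by (simp add: algebra_morphism_def)
next
  case (3 X)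
  then show ?case
    by (simp add: is_bialgebra_def algebra_morphism_Idt coalgebra_morphism_Idt)
next
  case (4 X Y Z f g)
  then have alg: "is_algebra M (bi_obj W) (bi_mult W) (bi_unit W)"
    and coalg: "is_coalgebra M (bi_obj W) (bi_comult W) (bi_counit W)" if "W \<in> {X, Y, Z}" for W
    using that by (auto simp: is_bialgebra_def)
  show ?case
    using 4(4,5) algebra_morphism_Cmp[OF alg[of X] alg[of Y] alg[of Z], of f g]
      coalgebra_morphism_Cmp[OF coalg[of X] coalg[of Y] coalg[of Z], of f g]
    by simp
qed

lemma is_functor_J: "is_functor M (Br_cat M) (J M)"
  unfolding is_functor_def J_def J_obj_def Br_cat_def
  by (auto simp: Hom_iff intro!: braided_object_Braid braided_object_morphism_Braid)

lemma is_functor_forget_Bialg: "is_functor (Bialg_cat M) M forget_Bialg"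
  unfolding is_functor_def forget_Bialg_def Bialg_cat_def
  by (auto simp: Hom_iff algebra_morphism_def is_bialgebra_def is_algebra_def)

lemma J_Bialg_obj_in_BrBialg_cat:
  "B \<in> Obj (Bialg_cat M) \<Longrightarrow> J_Bialg_obj M B \<in> Obj (BrBialg_cat M)"
  by (simp add: Bialg_cat_def BrBialg_cat_def J_Bialg_obj_def braided_bialgebra_Braid)

text \<open>These are the targets of the two whiskered transformations, whose agreement is part of
  \<open>ntrans_eq\<close>.\<close>

lemma functor_eq_forget_J_Bialg:
  "functor_eq (Bialg_cat M) (Br_cat M) (forget_BrBialg_Br \<circ>\<^sub>F J_Bialg M) (J M \<circ>\<^sub>F forget_Bialg)"
proof (rule category.functor_eqI[OF category_Bialg_cat])
  show "is_functor (Bialg_cat M) (Br_cat M) (J M \<circ>\<^sub>F forget_Bialg)"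
    by (rule is_functor_fcomp[OF is_functor_forget_Bialg is_functor_J])
qed (auto simp: fcomp_def forget_BrBialg_Br_def J_Bialg_def J_def forget_Bialg_def J_obj_def
      J_Bialg_obj_def underlying_Br_def Bialg_cat_def algebra_morphism_def Hom_iff)

end

section \<open>The primitive functor\<close>

locale primitive_equalizers = braided_monoidal_category M + preadditive_category M
  for M :: "('o, 'm, 'z) preadd_brmoncat_scheme" (structure)
    and \<xi> :: "('o, 'm) brbialg \<Rightarrow> 'm" +
  assumes tensor_left_equalizers: "X \<in> Obj M \<Longrightarrow> preserves_equalizers M M (tensor_left M X)"
    and tensor_right_equalizers: "X \<in> Obj M \<Longrightarrow> preserves_equalizers M M (tensor_right M X)"
    and xi_choice: "primitive_choice M \<xi>"
begin

text \<open>\<open>J_Bialg_obj\<close> only adjoins a braiding, which does not occur in the pair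
  being equalized; so the arrow chosen for the braided bialgebra equalizes the data of
  \<open>B\<close> itself.\<close>

lemma xi_equalizer:
  assumes "B \<in> Obj (Bialg_cat M)"
  shows "is_equalizer M (\<xi> (J_Bialg_obj M B)) (bi_comult B)
    ((\<iota> (bi_obj B) \<otimes>\<^sub>a bi_unit B) \<cdot> Inv M (\<r> (bi_obj B))
      \<oplus> (bi_unit B \<otimes>\<^sub>a \<iota> (bi_obj B)) \<cdot> Inv M (\<l> (bi_obj B)))"
  using xi_choice J_Bialg_obj_in_BrBialg_cat[OF assms]
  unfolding primitive_choice_def by (auto simp: J_Bialg_obj_def)

lemma xi_Hom:
  assumes "B \<in> Obj (Bialg_cat M)"
  shows "\<xi> (J_Bialg_obj M B) \<in> Hom M (Dom M (\<xi> (J_Bialg_obj M B))) (bi_obj B)"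
  using equalizer_Hom[OF xi_equalizer[OF assms]] assms
  by (auto simp: Hom_iff Bialg_cat_def is_bialgebra_def is_coalgebra_def)

lemma P_Br_obj_J_Bialg:
  assumes B: "B \<in> Obj (Bialg_cat M)"
  shows "P_Br_obj M \<xi> (J_Bialg_obj M B) = J_obj M (Dom M (\<xi> (J_Bialg_obj M B)))"
proof -
  let ?\<xi> = "\<xi> (J_Bialg_obj M B)"
  let ?P = "Dom M ?\<xi>"
  note \<xi> = xi_Hom[OF B]
  note T = Hom_Obj[OF \<xi>]
  have "P_braid M \<xi> (J_Bialg_obj M B) = \<c> ?P ?P"
    unfolding P_braid_def Let_def
  proof (rule the_equality)
    show *: "\<c> ?P ?P \<in> Hom M (?P \<otimes>\<^sub>o ?P) (?P \<otimes>\<^sub>o ?P)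
        \<and> (?\<xi> \<otimes>\<^sub>a ?\<xi>) \<cdot> \<c> ?P ?P = bb_braid (J_Bialg_obj M B) \<cdot> (?\<xi> \<otimes>\<^sub>a ?\<xi>)"
      using Braid_natural[OF \<xi> \<xi>] T by (simp add: J_Bialg_obj_def Braid_Hom)
    fix c
    assume c: "c \<in> Hom M (?P \<otimes>\<^sub>o ?P) (?P \<otimes>\<^sub>o ?P)
        \<and> (?\<xi> \<otimes>\<^sub>a ?\<xi>) \<cdot> c = bb_braid (J_Bialg_obj M B) \<cdot> (?\<xi> \<otimes>\<^sub>a ?\<xi>)"
    have "Cod M ?\<xi> \<in> Obj M"
      using \<xi> T by (simp add: Hom_iff)
    then show "c = \<c> ?P ?P"
      using tensor_equalizers_mono[OF xi_equalizer[OF B] xi_equalizer[OF B]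
          tensor_left_equalizers tensor_right_equalizers conjunct1[OF c] conjunct1[OF *]] c * T
      by argo
  qed
  then show ?thesis
    by (simp add: P_Br_obj_def J_obj_def)
qed

text \<open>A bialgebra morphism sends primitives to primitives: it commutes with
  \<open>\<Delta>\<close>, and since it preserves units it commutes with x (x) 1 and 1 (x) x. Hence
  f \<xi> equalizes the pair of \<open>B'\<close> and lifts uniquely.\<close>

lemma xi_lift:
  assumes f: "f \<in> Hom (Bialg_cat M) B B'"
  shows "\<exists>!h. h \<in> Hom M (Dom M (\<xi> (J_Bialg_obj M B))) (Dom M (\<xi> (J_Bialg_obj M B')))
    \<and> \<xi> (J_Bialg_obj M B') \<cdot> h = sa_arr f \<cdot> \<xi> (J_Bialg_obj M B)"
proof -
  let ?f = "sa_arr f" and ?\<xi> = "\<xi> (J_Bialg_obj M B)" and ?\<xi>' = "\<xi> (J_Bialg_obj M B')"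
  let ?A = "bi_obj B" and ?u = "bi_unit B" and ?\<Delta> = "bi_comult B"
  let ?A' = "bi_obj B'" and ?u' = "bi_unit B'" and ?\<Delta>' = "bi_comult B'"
  \<comment> \<open>\<open>?\<rho>\<close> is x \<mapsto> x (x) 1 and \<open>?\<sigma>\<close> is x
    \<mapsto> 1 (x) x; the primitives are where \<open>?\<Delta>\<close> equals their sum.\<close>
  let ?\<rho> = "(\<iota> ?A \<otimes>\<^sub>a ?u) \<cdot> Inv M (\<r> ?A)" and ?\<sigma> = "(?u \<otimes>\<^sub>a \<iota> ?A) \<cdot> Inv M (\<l> ?A)"
  let ?\<rho>' = "(\<iota> ?A' \<otimes>\<^sub>a ?u') \<cdot> Inv M (\<r> ?A')" and ?\<sigma>' = "(?u' \<otimes>\<^sub>a \<iota> ?A') \<cdot> Inv M (\<l> ?A')"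
  have B: "B \<in> Obj (Bialg_cat M)" "B' \<in> Obj (Bialg_cat M)"
    using f by (auto simp: Hom_iff Bialg_cat_def)
  have T: "?f \<in> Hom M ?A ?A'" "?A \<in> Obj M" "?A' \<in> Obj M" "?u \<in> Hom M \<I> ?A" "?u' \<in> Hom M \<I> ?A'"
      "?\<Delta> \<in> Hom M ?A (?A \<otimes>\<^sub>o ?A)" "?\<Delta>' \<in> Hom M ?A' (?A' \<otimes>\<^sub>o ?A')"
    and fu: "?f \<cdot> ?u = ?u'" and f\<Delta>: "?\<Delta>' \<cdot> ?f = (?f \<otimes>\<^sub>a ?f) \<cdot> ?\<Delta>"
    using f by (auto simp: Hom_iff Bialg_cat_def is_bialgebra_def is_algebra_def is_coalgebra_def
        algebra_morphism_def coalgebra_morphism_def)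
  note \<xi> = xi_Hom[OF B(1)]
  have \<rho>: "?\<rho> \<in> Hom M ?A (?A \<otimes>\<^sub>o ?A)" "?\<rho>' \<in> Hom M ?A' (?A' \<otimes>\<^sub>o ?A')"
    and \<sigma>: "?\<sigma> \<in> Hom M ?A (?A \<otimes>\<^sub>o ?A)" "?\<sigma>' \<in> Hom M ?A' (?A' \<otimes>\<^sub>o ?A')"
    using T by (auto simp: Hom_iff)
  have ff: "?f \<otimes>\<^sub>a ?f \<in> Hom M (?A \<otimes>\<^sub>o ?A) (?A' \<otimes>\<^sub>o ?A')"
    using T by (simp add: Hom_iff)
  note S = equalizer_Hom[OF xi_equalizer[OF B(1)]] equalizer_Hom[OF xi_equalizer[OF B(2)]]
  have "(?f \<otimes>\<^sub>a ?f) \<cdot> ?\<rho> = (\<iota> ?A' \<otimes>\<^sub>a ?u') \<cdot> ((?f \<otimes>\<^sub>a \<iota> \<I>) \<cdot> Inv M (\<r> ?A))"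
    using T fu by (simp add: Hom_iff)
  also have "\<dots> = ?\<rho>' \<cdot> ?f"
    unfolding Inv_RUnit_natural[OF T(1), symmetric] using T by (simp add: Hom_iff)
  finally have f\<rho>: "(?f \<otimes>\<^sub>a ?f) \<cdot> ?\<rho> = ?\<rho>' \<cdot> ?f" .
  have "(?f \<otimes>\<^sub>a ?f) \<cdot> ?\<sigma> = (?u' \<otimes>\<^sub>a \<iota> ?A') \<cdot> ((\<iota> \<I> \<otimes>\<^sub>a ?f) \<cdot> Inv M (\<l> ?A))"
    using T fu by (simp add: Hom_iff)
  also have "\<dots> = ?\<sigma>' \<cdot> ?f"
    unfolding Inv_LUnit_natural[OF T(1), symmetric] using T by (simp add: Hom_iff)
  finally have f\<sigma>: "(?f \<otimes>\<^sub>a ?f) \<cdot> ?\<sigma> = ?\<sigma>' \<cdot> ?f" .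
  \<comment> \<open>Move \<open>?f\<close> past the comultiplication, replace
    \<open>?\<Delta>\<close> by the sum on primitives, and move \<open>?f\<close> back through each
    summand by bilinearity of composition.\<close>
  have "?\<Delta>' \<cdot> (?f \<cdot> ?\<xi>) = ((?f \<otimes>\<^sub>a ?f) \<cdot> ?\<Delta>) \<cdot> ?\<xi>"
    using T \<xi> by (intro Cmp_reassoc f\<Delta>) (auto simp: Hom_iff)
  also have "\<dots> = (?f \<otimes>\<^sub>a ?f) \<cdot> (?\<Delta> \<cdot> ?\<xi>)"
    using T \<xi> by (intro Cmp_assoc_simp) (auto simp: Hom_iff)
  also have "?\<Delta> \<cdot> ?\<xi> = (?\<rho> \<oplus> ?\<sigma>) \<cdot> ?\<xi>"
    using S by simp
  also have "(?f \<otimes>\<^sub>a ?f) \<cdot> ((?\<rho> \<oplus> ?\<sigma>) \<cdot> ?\<xi>) = ((?f \<otimes>\<^sub>a ?f) \<cdot> (?\<rho> \<oplus> ?\<sigma>)) \<cdot> ?\<xi>"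
    using T \<xi> S by (intro Cmp_assoc_simp[symmetric]) (auto simp: Hom_iff)
  also have "(?f \<otimes>\<^sub>a ?f) \<cdot> (?\<rho> \<oplus> ?\<sigma>) = ?\<rho>' \<cdot> ?f \<oplus> ?\<sigma>' \<cdot> ?f"
    unfolding Cmp_Add_right[OF \<rho>(1) \<sigma>(1) ff] f\<rho> f\<sigma> ..
  also have "\<dots> = (?\<rho>' \<oplus> ?\<sigma>') \<cdot> ?f"
    unfolding Cmp_Add_left[OF T(1) \<rho>(2) \<sigma>(2)] ..
  also have "((?\<rho>' \<oplus> ?\<sigma>') \<cdot> ?f) \<cdot> ?\<xi> = (?\<rho>' \<oplus> ?\<sigma>') \<cdot> (?f \<cdot> ?\<xi>)"
    using T \<xi> S by (intro Cmp_assoc_simp) (auto simp: Hom_iff)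
  finally have "\<exists>!h. h \<in> Hom M (Dom M (?f \<cdot> ?\<xi>)) (Dom M ?\<xi>') \<and> ?\<xi>' \<cdot> h = ?f \<cdot> ?\<xi>"
    using T \<xi> by (intro equalizer_factor[OF xi_equalizer[OF B(2)]]) (auto simp: Hom_iff)
  moreover have "Dom M (?f \<cdot> ?\<xi>) = Dom M ?\<xi>"
    using T \<xi> by (simp add: Hom_iff)
  ultimately show ?thesis
    by simp
qed

section \<open>The functor P and its canonical transformation\<close>

lemma on_obj_P_functor: "on_obj (P_functor M \<xi>) B = Dom M (\<xi> (J_Bialg_obj M B))"
  by (simp add: P_functor_def fcomp_def forget_Br_def P_Br_def P_Br_obj_def J_Bialg_def)

lemma P_functor_arr:
  assumes f: "f \<in> Hom (Bialg_cat M) B B'"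
  shows "on_arr (P_functor M \<xi>) f \<in> Hom M (on_obj (P_functor M \<xi>) B) (on_obj (P_functor M \<xi>) B')"
    and "\<xi> (J_Bialg_obj M B') \<cdot> on_arr (P_functor M \<xi>) f = sa_arr f \<cdot> \<xi> (J_Bialg_obj M B)"
proof -
  have "sa_src f = B" "sa_tgt f = B'"
    using f by (auto simp: Hom_iff Bialg_cat_def)
  then have "on_arr (P_functor M \<xi>) f
      = (THE h. h \<in> Hom M (Dom M (\<xi> (J_Bialg_obj M B))) (Dom M (\<xi> (J_Bialg_obj M B')))
          \<and> \<xi> (J_Bialg_obj M B') \<cdot> h = sa_arr f \<cdot> \<xi> (J_Bialg_obj M B))"
    by (simp add: P_functor_def fcomp_def forget_Br_def P_Br_def J_Bialg_def)
  then show "on_arr (P_functor M \<xi>) f \<in> Hom M (on_obj (P_functor M \<xi>) B) (on_obj (P_functor M \<xi>) B')"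
    and "\<xi> (J_Bialg_obj M B') \<cdot> on_arr (P_functor M \<xi>) f = sa_arr f \<cdot> \<xi> (J_Bialg_obj M B)"
    using theI'[OF xi_lift[OF f]] by (auto simp: on_obj_P_functor)
qed

lemma P_functor_arr_eqI:
  assumes f: "f \<in> Hom (Bialg_cat M) B B'"
    and h: "h \<in> Hom M (on_obj (P_functor M \<xi>) B) (on_obj (P_functor M \<xi>) B')"
    and eq: "\<xi> (J_Bialg_obj M B') \<cdot> h = sa_arr f \<cdot> \<xi> (J_Bialg_obj M B)"
  shows "on_arr (P_functor M \<xi>) f = h"
  using xi_lift[OF f] P_functor_arr[OF f] h eq by (auto simp: on_obj_P_functor)

text \<open>Lifts are unique, so each functor law follows once the candidate, an identity or a
  composite of lifts, is seen to satisfy the defining square.\<close>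

lemma is_functor_P_functor: "is_functor (Bialg_cat M) M (P_functor M \<xi>)"
proof -
  interpret Bialg: category "Bialg_cat M"
    by (rule category_Bialg_cat)
  let ?P = "P_functor M \<xi>"
  have xi: "\<xi> (J_Bialg_obj M B) \<in> Hom M (on_obj ?P B) (bi_obj B)" if "B \<in> Obj (Bialg_cat M)" for B
    using xi_Hom[OF that] by (simp add: on_obj_P_functor)
  have obj: "on_obj ?P B \<in> Obj M" if "B \<in> Obj (Bialg_cat M)" for B
    using Hom_Obj[OF xi[OF that]] by simp
  show ?thesis
    unfolding is_functor_def
  proof (intro conjI ballI impI)
    fix B assume B: "B \<in> Obj (Bialg_cat M)"
    show "on_obj ?P B \<in> Obj M"
      by (rule obj[OF B])
    have "sa_arr (\<iota>\<^bsub>Bialg_cat M\<^esub> B) = \<iota> (bi_obj B)"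
      by (simp add: Bialg_cat_def)
    then show "on_arr ?P (\<iota>\<^bsub>Bialg_cat M\<^esub> B) = \<iota> (on_obj ?P B)"
      using xi[OF B] obj[OF B] by (intro P_functor_arr_eqI[OF Bialg.Idt_Hom[OF B]]) (auto simp: Hom_iff)
  next
    fix f assume "f \<in> Arr (Bialg_cat M)"
    then show "on_arr ?P f \<in> Hom M (on_obj ?P (Dom (Bialg_cat M) f)) (on_obj ?P (Cod (Bialg_cat M) f))"
      by (intro P_functor_arr) (simp add: Hom_iff)
  next
    fix f g assume fg: "f \<in> Arr (Bialg_cat M)" "g \<in> Arr (Bialg_cat M)" "Cod (Bialg_cat M) f = Dom (Bialg_cat M) g"
    define X Y Z where "X = Dom (Bialg_cat M) f" and "Y = Dom (Bialg_cat M) g" and "Z = Cod (Bialg_cat M) g"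
    have f: "f \<in> Hom (Bialg_cat M) X Y" and g: "g \<in> Hom (Bialg_cat M) Y Z"
      using fg by (auto simp: Hom_iff X_def Y_def Z_def)
    note Pf = P_functor_arr[OF f] and Pg = P_functor_arr[OF g]
    note xis = xi[OF conjunct1[OF Bialg.Hom_Obj[OF f]]] xi[OF conjunct1[OF Bialg.Hom_Obj[OF g]]]
      xi[OF conjunct2[OF Bialg.Hom_Obj[OF g]]]
    have T: "sa_arr f \<in> Hom M (bi_obj X) (bi_obj Y)" "sa_arr g \<in> Hom M (bi_obj Y) (bi_obj Z)"
      and c: "sa_arr (g \<cdot>\<^bsub>Bialg_cat M\<^esub> f) = sa_arr g \<cdot> sa_arr f"
      using f g by (auto simp: Hom_iff Bialg_cat_def algebra_morphism_def)
    \<comment> \<open>Pasting the defining squares of \<open>f\<close> and \<open>g\<close> gives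
      the one of their composite.\<close>
    have "\<xi> (J_Bialg_obj M Z) \<cdot> (on_arr ?P g \<cdot> on_arr ?P f)
        = (sa_arr g \<cdot> \<xi> (J_Bialg_obj M Y)) \<cdot> on_arr ?P f"
      using xis T Pf(1) Pg by (intro Cmp_reassoc) (auto simp: Hom_iff)
    also have "\<dots> = sa_arr g \<cdot> (sa_arr f \<cdot> \<xi> (J_Bialg_obj M X))"
      unfolding Pf(2)[symmetric] using xis T Pf(1) by (intro Cmp_assoc_simp) (auto simp: Hom_iff)
    also have "\<dots> = sa_arr (g \<cdot>\<^bsub>Bialg_cat M\<^esub> f) \<cdot> \<xi> (J_Bialg_obj M X)"
      unfolding c using xis T by (simp add: Hom_iff)
    finally show "on_arr ?P (g \<cdot>\<^bsub>Bialg_cat M\<^esub> f) = on_arr ?P g \<cdot> on_arr ?P f"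
      by (intro P_functor_arr_eqI[OF Bialg.Cmp_Hom[OF f g] Cmp_Hom[OF Pf(1) Pg(1)]])
  qed
qed

text \<open>Naturality is the defining square of P on arrows.\<close>

lemma is_ntrans_xi_Bialg: "is_ntrans (Bialg_cat M) M (xi_Bialg M \<xi>)"
proof -
  interpret Bialg: category "Bialg_cat M"
    by (rule category_Bialg_cat)
  have "\<xi> (J_Bialg_obj M (Cod (Bialg_cat M) f)) \<cdot> on_arr (P_functor M \<xi>) f
      = sa_arr f \<cdot> \<xi> (J_Bialg_obj M (Dom (Bialg_cat M) f))" if "f \<in> Arr (Bialg_cat M)" for f
    using that by (intro P_functor_arr) (simp add: Hom_iff)
  then show ?thesis
    using is_functor_P_functor is_functor_forget_Bialg xi_Hom
    by (auto simp: is_ntrans_def xi_Bialg_def on_obj_P_functor forget_Bialg_def)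
qed

lemma functor_eq_P_Br_J_Bialg:
  "functor_eq (Bialg_cat M) (Br_cat M) (P_Br M \<xi> \<circ>\<^sub>F J_Bialg M) (J M \<circ>\<^sub>F P_functor M \<xi>)"
proof (rule category.functor_eqI[OF category_Bialg_cat])
  show "is_functor (Bialg_cat M) (Br_cat M) (J M \<circ>\<^sub>F P_functor M \<xi>)"
    by (rule is_functor_fcomp[OF is_functor_P_functor is_functor_J])
next
  fix B assume B: "B \<in> Obj (Bialg_cat M)"
  then show "on_obj (P_Br M \<xi> \<circ>\<^sub>F J_Bialg M) B = on_obj (J M \<circ>\<^sub>F P_functor M \<xi>) B"
    using P_Br_obj_J_Bialg[OF B] by (simp add: fcomp_def P_Br_def J_Bialg_def J_def on_obj_P_functor)
next
  fix f assume "f \<in> Arr (Bialg_cat M)"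
  then have f: "f \<in> Hom (Bialg_cat M) (sa_src f) (sa_tgt f)"
    by (simp add: Hom_iff Bialg_cat_def)
  then have B: "sa_src f \<in> Obj (Bialg_cat M)" "sa_tgt f \<in> Obj (Bialg_cat M)"
    by (auto simp: Hom_iff Bialg_cat_def)
  \<comment> \<open>\<open>P_functor\<close> forgets down from this very composite, so the
    underlying arrows coincide by definition; only the recorded ends must be compared, and
    \<open>P_Br_obj_J_Bialg\<close> does that.\<close>
  have "on_arr (P_Br M \<xi> \<circ>\<^sub>F J_Bialg M) f
      = SArr (P_Br_obj M \<xi> (J_Bialg_obj M (sa_src f))) (on_arr (P_functor M \<xi>) f)
          (P_Br_obj M \<xi> (J_Bialg_obj M (sa_tgt f)))"
    by (simp add: P_functor_def fcomp_def forget_Br_def P_Br_def J_Bialg_def)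
  then show "on_arr (P_Br M \<xi> \<circ>\<^sub>F J_Bialg M) f = on_arr (J M \<circ>\<^sub>F P_functor M \<xi>) f"
    using P_functor_arr(1)[OF f] P_Br_obj_J_Bialg[OF B(1)] P_Br_obj_J_Bialg[OF B(2)]
    by (simp add: fcomp_def J_def on_obj_P_functor Hom_iff)
qed

lemma ntrans_eq_xi_J_Bialg:
  "ntrans_eq (Bialg_cat M) (Br_cat M) (xi_BrBialg M \<xi> \<star>\<^sub>R J_Bialg M) (J M \<star>\<^sub>L xi_Bialg M \<xi>)"
proof (rule category.ntrans_eqI)
  show "category (Bialg_cat M)"
    by (rule category_Bialg_cat)
  show "is_ntrans (Bialg_cat M) (Br_cat M) (J M \<star>\<^sub>L xi_Bialg M \<xi>)"
    by (rule category.is_ntrans_whisker_left[OF category_Bialg_cat is_functor_J is_ntrans_xi_Bialg])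
next
  fix B assume B: "B \<in> Obj (Bialg_cat M)"
  \<comment> \<open>The components share the underlying arrow, but a structured arrow also records
    its ends. This equation matches the targets; \<open>P_Br_obj_J_Bialg\<close> matches the
    sources.\<close>
  have "underlying_Br (J_Bialg_obj M B) = J_obj M (bi_obj B)"
    by (simp add: underlying_Br_def J_Bialg_obj_def J_obj_def)
  moreover have "Cod M (\<xi> (J_Bialg_obj M B)) = bi_obj B"
    using xi_Hom[OF B] by (simp add: Hom_iff)
  ultimately show "nt_comp (xi_BrBialg M \<xi> \<star>\<^sub>R J_Bialg M) B = nt_comp (J M \<star>\<^sub>L xi_Bialg M \<xi>) B"
    by (simp add: whisker_right_def whisker_left_def xi_BrBialg_def xi_Bialg_def J_Bialg_def J_def
        P_Br_obj_J_Bialg[OF B])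
next
  show "functor_eq (Bialg_cat M) (Br_cat M) (nt_src (xi_BrBialg M \<xi> \<star>\<^sub>R J_Bialg M))
      (nt_src (J M \<star>\<^sub>L xi_Bialg M \<xi>))"
    using functor_eq_P_Br_J_Bialg
    by (simp only: whisker_right_def whisker_left_def xi_BrBialg_def xi_Bialg_def ntrans.sel)
next
  show "functor_eq (Bialg_cat M) (Br_cat M) (nt_tgt (xi_BrBialg M \<xi> \<star>\<^sub>R J_Bialg M))
      (nt_tgt (J M \<star>\<^sub>L xi_Bialg M \<xi>))"
    using functor_eq_forget_J_Bialg
    by (simp only: whisker_right_def whisker_left_def xi_BrBialg_def xi_Bialg_def ntrans.sel)
qed

end

theorem proposition4p7:
  fixes M :: "('o, 'm) preadd_brmoncat"
    and \<xi> :: "('o, 'm) brbialg \<Rightarrow> 'm"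
  assumes "braided_monoidal_category M"
    and "preadditive_category M"
    and "has_equalizers M"
    and "\<And>X. X \<in> Obj M \<Longrightarrow> additive_functor M M (tensor_left M X)"
    and "\<And>X. X \<in> Obj M \<Longrightarrow> additive_functor M M (tensor_right M X)"
    and "\<And>X. X \<in> Obj M \<Longrightarrow> preserves_equalizers M M (tensor_left M X)"
    and "\<And>X. X \<in> Obj M \<Longrightarrow> preserves_equalizers M M (tensor_right M X)"
    and "primitive_choice M \<xi>"
  shows "functor_eq (Bialg_cat M) (Br_cat M)
           (P_Br M \<xi> \<circ>\<^sub>F J_Bialg M) (J M \<circ>\<^sub>F P_functor M \<xi>)
       \<and> ntrans_eq (Bialg_cat M) (Br_cat M)
           (xi_BrBialg M \<xi> \<star>\<^sub>R J_Bialg M) (J M \<star>\<^sub>L xi_Bialg M \<xi>)"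
proof -
  interpret primitive_equalizers M \<xi>
    using assms by (auto intro!: primitive_equalizers.intro primitive_equalizers_axioms.intro)
  show ?thesis
    using functor_eq_P_Br_J_Bialg ntrans_eq_xi_J_Bialg by blast
qed

end
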